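(* Let $(X,h,Z)$ be a fiberwise essentially minimal zero-dimensional system. There is an ordered Bratteli diagram $B=(V,E,\leq)$ with a perfect ordering such that: (a) The system $(X_B,h_B,X_{B,\min})$ is conjugate to $(X,h,Z)$. (b) For each $v$ in $V_{\min}$ (resp. $V_{\max}$) there is a $v'$ in $V_{\min}$ (resp. $V_{\max}$) and an edge $e$ in $E_{\min}$ (resp. $E_{\max}$) such that $s(e)=v$ and $r(e)=v'$. (c) For each $v$ in $V_{\min}$ (resp. $V_{\max}$), each $e$ in $E_{\min}$ (resp. $E_{\max}$) with $r(e)\in R(v)$ satisfies $s(e)=v$. (d) For each $v$ in $V_{\min}$ (or $V_{\max}$) and each $m\in\mathbb{Z}_{>0}$, $R^m(v)=(R^m\circ S^m\circ R^m)(v)$.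
   Context: Systems. A zero-dimensional system $(X,h)$ is a totally disconnected compact metrizable space $X$ with a homeomorphism $h:X\to X$. A minimal set is a nonempty closed $h$-invariant subset with no nonempty $h$-invariant proper closed subsets; $(X,h)$ is essentially minimal if it has a unique minimal set. For closed $Z\subset X$, the triple $(X,h,Z)$ is a fiberwise essentially minimal zero-dimensional system if there is a quotient map $\psi:X\to Z$ such that (a) $\psi|_Z=\mathrm{id}_Z$; (b) $\psi\circ h=\psi$; (c) for each $z\in Z$, $(\psi^{-1}(z),h|_{\psi^{-1}(z)})$ is essentially minimal and $z$ is in its minimal set. Triples $(X_1,h_1,Z_1)$ and $(X_2,h_2,Z_2)$ are conjugate if there is a homeomorphism $F:X_1\to X_2$ with $F\circ h_1=h_2\circ F$ and $F(Z_1)=Z_2$. Bratteli diagrams. A Bratteli diagram is a pair $(V,E)$ with $V=\bigsqcup_{n\ge0}V_n$ (vertices) and $E=\bigsqcup_{n\ge1}E_n$ (edges), where $V_0=\{v_0\}$, all $V_n$ and $E_n$ are finite and nonempty, together with maps $r,s:E\to V$ such that $s(e)\in V_{n-1}$ and $r(e)\in V_n$ for $e\in E_n$, $s^{-1}(v)\neq\varnothing$ for all $v\in V$, and $r^{-1}(v)\ne\varnothing$ for all $v\in V\setminus V_0$. For $v\in V$, $R(v)=r(s^{-1}(v))$; for $v\in V\setminus V_0$, $S(v)=s(r^{-1}(v))$. For sets of vertices these are extended by unions, and $R^m,S^m$ are $m$-fold iterates. An ordered Bratteli diagram $B=(V,E,\le)$ is a Bratteli diagram with a partial order $\le$ on $E$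 such that $e,e'$ are comparable iff $r(e)=r(e')$. $E_{\min}$ (resp. $E_{\max}$) is the set of edges minimal (resp. maximal) for $\le$; $V_{\min}$ (resp. $V_{\max}$) is the set of $v\in V$ for which there is $e\in E_{\min}$ (resp. $E_{\max}$) with $s(e)=v$. Path space. $X_B$ is the set of sequences $x=(x_1,x_2,\ldots)$ with $x_n\in E_n$ and $r(x_n)=s(x_{n+1})$ for all $n\ge 1$, with the topology generated by the sets $U(e_1,\ldots,e_k)=\{x: x_j=e_j,\ 1\le j\le k\}$. $X_{B,\min}$ (resp. $X_{B,\max}$) is the set of $x\in X_B$ with all $x_j\in E_{\min}$ (resp. $E_{\max}$). Vershik map. The partial Vershik transformation $\widetilde h_B:(X_B\setminus X_{B,\max})\cup X_{B,\min}\to(X_B\setminus X_{B,\min})\cup X_{B,\max}$ is defined as follows. If $x\in X_{B,\max}\cap X_{B,\min}$, then $\widetilde h_B(x)=x$. If $x\in X_B\setminus X_{B,\max}$, let $k$ be smallest with $x_k\notin E_{\max}$, let $y_k$ be the successor of $x_k$, let $(y_1,\ldots,y_{k-1})$ be the unique path from $v_0$ to $s(y_k)$ consisting of edges in $E_{\min}$, and set $\widetilde h_B(x)=(y_1,\ldots,y_k,x_{k+1},x_{k+2},\ldots)$. The orbit $\mathrm{orb}_{\widetilde h_B}(e)$ consists of all forward and backward iterates of $e$ that are defined. The ordering on $B$ is perfect if for every $e\in X_{B,\min}$ the set $\overline{\mathrm{orb}_{\widetilde h_B}(e)}\cap X_{B,\max}$ has exactly one element and for every $e\in X_{B,\max}$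 the set $\overline{\mathrm{orb}_{\widetilde h_B}(e)}\cap X_{B,\min}$ has exactly one element. In that case the Vershik transformation $h_B:X_B\to X_B$ is the extension of $\widetilde h_B$ which, for each $e\in X_{B,\min}$, sends the unique element of $\overline{\mathrm{orb}_{\widetilde h_B}(e)}\cap X_{B,\max}$ to $e$. *)

theory Defs
  imports "HOL-Analysis.Analysis"
begin

section \<open>Zero-dimensional systems\<close>

definition totally_disconnected_space :: "'a topology \<Rightarrow> bool" where
  "totally_disconnected_space X \<longleftrightarrow> (\<forall>S. connectedin X S \<longrightarrow> (\<exists>a. S \<subseteq> {a}))"

text \<open>Only the values of \<open>h\<close> on \<open>topspace X\<close> matter. The empty space is not excluded here.\<close>

definition zero_dim_system :: "'a topology \<Rightarrow> ('a \<Rightarrow> 'a) \<Rightarrow> bool" where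
  "zero_dim_system X h \<longleftrightarrow>
     totally_disconnected_space X \<and> compact_space X \<and> metrizable_space X \<and> homeomorphic_map X X h"

text \<open>Invariance of \<open>M\<close> under the homeomorphism \<open>h\<close> means \<open>h ` M = M\<close>. On a compact space
  the weaker \<open>h ` M \<subseteq> M\<close> would give the same minimal sets.\<close>

definition invariant_closed_set :: "'a topology \<Rightarrow> ('a \<Rightarrow> 'a) \<Rightarrow> 'a set \<Rightarrow> bool" where
  "invariant_closed_set X h M \<longleftrightarrow> closedin X M \<and> M \<noteq> {} \<and> h ` M = M"

definition minimal_set :: "'a topology \<Rightarrow> ('a \<Rightarrow> 'a) \<Rightarrow> 'a set \<Rightarrow> bool" where
  "minimal_set X h M \<longleftrightarrow>
     invariant_closed_set X h M \<and> (\<forall>N. invariant_closed_set X h N \<longrightarrow> \<not> N \<subset> M)"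

definition essentially_minimal :: "'a topology \<Rightarrow> ('a \<Rightarrow> 'a) \<Rightarrow> bool" where
  "essentially_minimal X h \<longleftrightarrow> zero_dim_system X h \<and> (\<exists>!M. minimal_set X h M)"

abbreviation fiber_topology :: "'a topology \<Rightarrow> ('a \<Rightarrow> 'b) \<Rightarrow> 'b \<Rightarrow> 'a topology" where
  "fiber_topology X \<psi> z \<equiv> subtopology X {x \<in> topspace X. \<psi> x = z}"

definition fiberwise_essentially_minimal :: "'a topology \<Rightarrow> ('a \<Rightarrow> 'a) \<Rightarrow> 'a set \<Rightarrow> bool" where
  "fiberwise_essentially_minimal X h Z \<longleftrightarrow>
     zero_dim_system X h \<and> closedin X Z \<and>
     (\<exists>\<psi>. quotient_map X (subtopology X Z) \<psi> \<and>
          (\<forall>z\<in>Z. \<psi> z = z) \<and>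
          (\<forall>x\<in>topspace X. \<psi> (h x) = \<psi> x) \<and>
          (\<forall>z\<in>Z. essentially_minimal (fiber_topology X \<psi> z) h \<and>
                  (\<exists>M. minimal_set (fiber_topology X \<psi> z) h M \<and> z \<in> M)))"

definition conjugate_triples ::
  "'a topology \<Rightarrow> ('a \<Rightarrow> 'a) \<Rightarrow> 'a set \<Rightarrow> 'b topology \<Rightarrow> ('b \<Rightarrow> 'b) \<Rightarrow> 'b set \<Rightarrow> bool" where
  "conjugate_triples X1 h1 Z1 X2 h2 Z2 \<longleftrightarrow>
     (\<exists>F. homeomorphic_map X1 X2 F \<and> (\<forall>x\<in>topspace X1. F (h1 x) = h2 (F x)) \<and> F ` Z1 = Z2)"


section \<open>Ordered Bratteli diagrams\<close>

text \<open>\<open>Vlevel B n\<close> is \<open>V_n\<close> and, for \<open>n \<ge> 1\<close>, \<open>Elevel B n\<close> is \<open>E_n\<close>;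
  \<open>Elevel B 0\<close> is junk and is never used. \<open>(e, e') \<in> ord B\<close> means \<open>e \<le> e'\<close>.\<close>

record ('v, 'e) bratteli =
  Vlevel :: "nat \<Rightarrow> 'v set"
  Elevel :: "nat \<Rightarrow> 'e set"
  src :: "'e \<Rightarrow> 'v"
  rng :: "'e \<Rightarrow> 'v"
  ord :: "('e \<times> 'e) set"

definition verts :: "('v, 'e) bratteli \<Rightarrow> 'v set" where
  "verts B = (\<Union>n. Vlevel B n)"

definition edges :: "('v, 'e) bratteli \<Rightarrow> 'e set" where
  "edges B = (\<Union>n\<in>{1..}. Elevel B n)"

definition bratteli_diagram :: "('v, 'e) bratteli \<Rightarrow> bool" where
  "bratteli_diagram B \<longleftrightarrow>
     disjoint_family (Vlevel B) \<and> disjoint_family_on (Elevel B) {1..} \<and>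
     (\<exists>v\<^sub>0. Vlevel B 0 = {v\<^sub>0}) \<and>
     (\<forall>n. finite (Vlevel B n) \<and> Vlevel B n \<noteq> {}) \<and>
     (\<forall>n\<ge>1. finite (Elevel B n) \<and> Elevel B n \<noteq> {}) \<and>
     (\<forall>n\<ge>1. \<forall>e\<in>Elevel B n. src B e \<in> Vlevel B (n - 1) \<and> rng B e \<in> Vlevel B n) \<and>
     (\<forall>v\<in>verts B. {e \<in> edges B. src B e = v} \<noteq> {}) \<and>
     (\<forall>v\<in>verts B - Vlevel B 0. {e \<in> edges B. rng B e = v} \<noteq> {})"

definition ordered_bratteli_diagram :: "('v, 'e) bratteli \<Rightarrow> bool" where
  "ordered_bratteli_diagram B \<longleftrightarrow>
     bratteli_diagram B \<and> partial_order_on (edges B) (ord B) \<and>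
     (\<forall>e\<in>edges B. \<forall>e'\<in>edges B.
        ((e, e') \<in> ord B \<or> (e', e) \<in> ord B) \<longleftrightarrow> rng B e = rng B e')"

definition R_of :: "('v, 'e) bratteli \<Rightarrow> 'v \<Rightarrow> 'v set" where
  "R_of B v = rng B ` {e \<in> edges B. src B e = v}"

definition S_of :: "('v, 'e) bratteli \<Rightarrow> 'v \<Rightarrow> 'v set" where
  "S_of B v = src B ` {e \<in> edges B. rng B e = v}"

definition R_iter :: "('v, 'e) bratteli \<Rightarrow> nat \<Rightarrow> 'v set \<Rightarrow> 'v set" where
  "R_iter B m = (\<lambda>W. \<Union>v\<in>W. R_of B v) ^^ m"

text \<open>The root has no incoming edges, so \<open>S_of B v = {}\<close> for it.\<close>

definition S_iter :: "('v, 'e) bratteli \<Rightarrow> nat \<Rightarrow> 'v set \<Rightarrow> 'v set" where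
  "S_iter B m = (\<lambda>W. \<Union>v\<in>W. S_of B v) ^^ m"

definition Emin :: "('v, 'e) bratteli \<Rightarrow> 'e set" where
  "Emin B = {e \<in> edges B. \<forall>e'\<in>edges B. (e', e) \<in> ord B \<longrightarrow> e' = e}"

definition Emax :: "('v, 'e) bratteli \<Rightarrow> 'e set" where
  "Emax B = {e \<in> edges B. \<forall>e'\<in>edges B. (e, e') \<in> ord B \<longrightarrow> e' = e}"

definition Vmin :: "('v, 'e) bratteli \<Rightarrow> 'v set" where
  "Vmin B = {v \<in> verts B. \<exists>e\<in>Emin B. src B e = v}"

definition Vmax :: "('v, 'e) bratteli \<Rightarrow> 'v set" where
  "Vmax B = {v \<in> verts B. \<exists>e\<in>Emax B. src B e = v}"


section \<open>Path space\<close>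

text \<open>The path \<open>(x_1, x_2, \<dots>)\<close> is a function on \<open>nat\<close> whose value at \<open>0\<close> is \<open>undefined\<close>.\<close>

definition paths :: "('v, 'e) bratteli \<Rightarrow> (nat \<Rightarrow> 'e) set" where
  "paths B = {x \<in> (\<Pi>\<^sub>E n\<in>{1..}. Elevel B n). \<forall>n\<ge>1. rng B (x n) = src B (x (Suc n))}"

definition cylinder :: "('v, 'e) bratteli \<Rightarrow> nat \<Rightarrow> (nat \<Rightarrow> 'e) \<Rightarrow> (nat \<Rightarrow> 'e) set" where
  "cylinder B k e = {x \<in> paths B. \<forall>j\<in>{1..k}. x j = e j}"

definition path_topology :: "('v, 'e) bratteli \<Rightarrow> (nat \<Rightarrow> 'e) topology" where
  "path_topology B = topology_generated_by {cylinder B k e | k e. k \<ge> 1}"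

lemma topspace_path_topology [simp]: "topspace (path_topology B) = paths B"
proof
  show "topspace (path_topology B) \<subseteq> paths B"
    unfolding path_topology_def topology_generated_by_topspace by (auto simp: cylinder_def)
  show "paths B \<subseteq> topspace (path_topology B)"
  proof
    fix x assume "x \<in> paths B"
    then have "x \<in> cylinder B 1 x" by (simp add: cylinder_def)
    moreover have "cylinder B 1 x \<in> {cylinder B k e | k e. k \<ge> 1}" by blast
    ultimately show "x \<in> topspace (path_topology B)"
      unfolding path_topology_def topology_generated_by_topspace by (rule UnionI[rotated])
  qed
qed

definition paths_min :: "('v, 'e) bratteli \<Rightarrow> (nat \<Rightarrow> 'e) set" where
  "paths_min B = {x \<in> paths B. \<forall>j\<ge>1. x j \<in> Emin B}"

definition paths_max :: "('v, 'e) bratteli \<Rightarrow> (nat \<Rightarrow> 'e) set" where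
  "paths_max B = {x \<in> paths B. \<forall>j\<ge>1. x j \<in> Emax B}"


section \<open>The Vershik transformation\<close>

definition is_successor :: "('v, 'e) bratteli \<Rightarrow> 'e \<Rightarrow> 'e \<Rightarrow> bool" where
  "is_successor B e f \<longleftrightarrow>
     f \<in> edges B \<and> f \<noteq> e \<and> (e, f) \<in> ord B \<and>
     (\<forall>g\<in>edges B. g \<noteq> e \<and> (e, g) \<in> ord B \<longrightarrow> (f, g) \<in> ord B)"

definition vershik_dom :: "('v, 'e) bratteli \<Rightarrow> (nat \<Rightarrow> 'e) set" where
  "vershik_dom B = (paths B - paths_max B) \<union> paths_min B"

text \<open>That \<open>y\<close> is again a path forces \<open>(y_1, \<dots>, y_{k-1})\<close> to be a path from the root to the
  source of \<open>y_k\<close>. Meaningful only for \<open>x \<in> vershik_dom B\<close>.\<close>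

definition partial_vershik :: "('v, 'e) bratteli \<Rightarrow> (nat \<Rightarrow> 'e) \<Rightarrow> (nat \<Rightarrow> 'e)" where
  "partial_vershik B x =
     (if x \<in> paths_max B \<inter> paths_min B then x
      else let k = (LEAST k. k \<ge> 1 \<and> x k \<notin> Emax B)
           in (THE y. y \<in> paths B \<and> (\<forall>j\<in>{1..<k}. y j \<in> Emin B) \<and>
                      is_successor B (x k) (y k) \<and> (\<forall>j>k. y j = x j)))"

definition vershik_graph :: "('v, 'e) bratteli \<Rightarrow> ((nat \<Rightarrow> 'e) \<times> (nat \<Rightarrow> 'e)) set" where
  "vershik_graph B = {(x, partial_vershik B x) | x. x \<in> vershik_dom B}"

definition vershik_orbit :: "('v, 'e) bratteli \<Rightarrow> (nat \<Rightarrow> 'e) \<Rightarrow> (nat \<Rightarrow> 'e) set" where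
  "vershik_orbit B x = (vershik_graph B)\<^sup>* `` {x} \<union> ((vershik_graph B)\<inverse>)\<^sup>* `` {x}"

definition orbit_closure :: "('v, 'e) bratteli \<Rightarrow> (nat \<Rightarrow> 'e) \<Rightarrow> (nat \<Rightarrow> 'e) set" where
  "orbit_closure B x = path_topology B closure_of vershik_orbit B x"

definition perfect_ordering :: "('v, 'e) bratteli \<Rightarrow> bool" where
  "perfect_ordering B \<longleftrightarrow>
     (\<forall>e\<in>paths_min B. \<exists>!x. x \<in> orbit_closure B e \<inter> paths_max B) \<and>
     (\<forall>e\<in>paths_max B. \<exists>!x. x \<in> orbit_closure B e \<inter> paths_min B)"

text \<open>A predicate rather than a function: perfectness alone does not make the assignment
  ``unique element of \<open>orbit_closure B e \<inter> paths_max B\<close> goes to \<open>e\<close>'' a bijection from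
  \<open>paths_min B\<close> onto \<open>paths_max B\<close>. An injective \<open>g\<close> with this property is determined on
  \<open>paths B\<close>: \<open>partial_vershik B\<close> already attains every value outside
  \<open>paths_min B - paths_max B\<close>, so \<open>g\<close> maps \<open>paths_max B - paths_min B\<close> into
  \<open>paths_min B - paths_max B\<close>, and the third clause fixes the preimage of each point there.\<close>

definition vershik_transformation ::
  "('v, 'e) bratteli \<Rightarrow> ((nat \<Rightarrow> 'e) \<Rightarrow> (nat \<Rightarrow> 'e)) \<Rightarrow> bool" where
  "vershik_transformation B g \<longleftrightarrow>
     g \<in> paths B \<rightarrow> paths B \<and>
     (\<forall>x\<in>vershik_dom B. g x = partial_vershik B x) \<and>
     (\<forall>e\<in>paths_min B. \<forall>x\<in>orbit_closure B e \<inter> paths_max B. g x = e)"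

end

theory Submission
  imports Defs
begin

text \<open>The diagram records how a shrinking sequence of clopen neighbourhoods of \<open>Z\<close> is visited by the
  orbits of \<open>h\<close>.

  Essential minimality of the fibres enters once, through recurrence: the closure of every forward
  and of every backward half-orbit contains a minimal set of its fibre, hence the marked point of
  that fibre. Every open set containing \<open>Z\<close> is therefore visited by every orbit in both directions,
  and a clopen neighbourhood \<open>Y\<close> of \<open>Z\<close> has locally constant first return times. Cutting \<open>Y\<close> into finitely
  many clopen pieces by a label that determines the return time presents \<open>X\<close> as a finite union of
  towers with bases in \<open>Y\<close>: a point is located by the label of its tower and its floor in it.

  Take \<open>Y 0 = X\<close> and clopen sets \<open>Y (Suc n) \<subseteq> Y n\<close> with intersection \<open>Z\<close>, and let a label at level
  \<open>n + 1\<close> contain the whole itinerary of the tower through the towers of level \<open>n\<close>. The towers of level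
  \<open>n\<close> are the vertices of level \<open>n\<close>; the edges into a tower of level \<open>n + 1\<close> are its successive visits to
  \<open>Y n\<close>, in the order of time. A point \<open>x\<close> determines the path of the visits during which its orbit
  passes through \<open>x\<close>. If the itineraries also record membership in clopen sets that separate the points
  of \<open>X\<close>, then this map is injective; it is surjective by compactness, and so it is a
  homeomorphism onto the path space (\<open>homeomorphic_path_of\<close>). An edge is minimal iff it is the first
  visit and maximal iff it is the last, so the minimal paths come from \<open>\<Inter>n. Y n = Z\<close> and the
  maximal ones from \<open>h\<inverse> Z\<close>, and the successor of a path is the path of the image under \<open>h\<close>
  (\<open>partial_vershik_path_of\<close>). Since \<open>Z\<close> meets each fibre in one point, an orbit closure contains at most
  one minimal and one maximal path, and the return times to \<open>Y n\<close> show that the orbit closure of a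
  minimal path contains a maximal one, and conversely.

  Conditions (b), (c) and (d) need more care in the choice of the towers. Even inside one piece of a
  clopen partition of \<open>Z\<close>, the points of \<open>Z\<close> may lie in several towers, and a higher tower could pass
  through more than one of them. To prevent this, the label of a base point \<open>y\<close> also contains the
  itineraries belonging to \<open>\<psi> y\<close> and to \<open>h\<inverse> (\<psi> y)\<close>. Since \<open>\<psi>\<close> is invariant, this only cuts \<open>X\<close> along
  invariant clopen sets, and afterwards each tower knows the two towers that contain \<open>\<psi> x\<close> and
  \<open>h\<inverse> (\<psi> x)\<close> for all of its points \<open>x\<close>. Choosing \<open>Y (Suc n)\<close> so small that its points share these two
  towers with their images under \<open>\<psi>\<close>, the extremal edges leave only from towers of marked points, and
  a tower of a higher level meets exactly one of these for each of the two kinds. The three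
  conditions follow from this, by one argument for both kinds (\<open>marked_vertices\<close>).\<close>

section \<open>Separating points by countably many clopen sets\<close>

text \<open>In a compact Hausdorff space quasi-components are connected components.\<close>

lemma totally_disconnected_compact_clopen_separation:
  assumes "compact_space X" "Hausdorff_space X" "totally_disconnected_space X"
    and "x \<in> topspace X" "y \<in> topspace X" "x \<noteq> y"
  obtains C where "openin X C" "closedin X C" "x \<in> C" "y \<notin> C"
proof -
  let ?Q = "quasi_component_of_set X x"
  have "?Q \<in> connected_components_of X"
    using quasi_eq_connected_components_of[of X] assms quasi_components_of_def by fastforce
  then have "connectedin X ?Q" by (rule connectedin_connected_components_of)
  then obtain a where "?Q \<subseteq> {a}" using assms(3) unfolding totally_disconnected_space_def by blast
  moreover have "x \<in> ?Q" using assms by simp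
  ultimately have "y \<notin> ?Q" using assms(6) by blast
  then show ?thesis using assms that unfolding quasi_component_of by blast
qed

lemma compact_metrizable_imp_second_countable:
  assumes "compact_space X" "metrizable_space X"
  shows "second_countable X"
proof -
  obtain M d where Md: "Metric_space M d" and X: "X = Metric_space.mtopology M d"
    using assms(2) by (auto simp: metrizable_space_def)
  interpret Metric_space M d by fact
  have "mtotally_bounded M"
    using assms(1) X compactin_imp_mtotally_bounded by (simp add: compact_space_def)
  then have "\<exists>K. finite K \<and> K \<subseteq> M \<and> M \<subseteq> (\<Union>x\<in>K. mball x (1 / Suc n))" for n
    unfolding mtotally_bounded_def by (metis of_nat_0_less_iff zero_less_Suc zero_less_divide_1_iff)
  then obtain K where K: "\<And>n. finite (K n)" "\<And>n. K n \<subseteq> M" "\<And>n. M \<subseteq> (\<Union>x\<in>K n. mball x (1 / Suc n))"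
    by metis
  define \<B> where "\<B> = (\<Union>n. (\<lambda>x. mball x (1 / Suc n)) ` K n)"
  have "\<exists>V\<in>\<B>. x \<in> V \<and> V \<subseteq> U" if U: "openin X U" "x \<in> U" for U x
  proof -
    obtain \<epsilon> where \<epsilon>: "\<epsilon> > 0" "mball x \<epsilon> \<subseteq> U" and xM: "x \<in> M"
      using U unfolding X openin_mtopology by blast
    obtain n where n: "2 / real (Suc n) < \<epsilon>"
      using reals_Archimedean[of "\<epsilon>/2"] \<epsilon> by (auto simp: field_simps)
    obtain k where k: "k \<in> K n" "x \<in> mball k (1 / Suc n)"
      using K(3)[of n] xM by blast
    have "mball k (1 / Suc n) \<subseteq> mball x \<epsilon>"
    proof
      fix y assume y: "y \<in> mball k (1 / Suc n)"
      then have "d x y \<le> d x k + d k y" using k by (auto intro: triangle)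
      also have "\<dots> < 2 / real (Suc n)" using y k by (auto simp: commute field_simps)
      finally show "y \<in> mball x \<epsilon>" using n y xM by auto
    qed
    then show ?thesis using k \<epsilon> unfolding \<B>_def by blast
  qed
  moreover have "countable \<B>" unfolding \<B>_def using K(1) by (auto intro: countable_finite)
  moreover have "\<forall>V\<in>\<B>. openin X V" unfolding \<B>_def X by auto
  ultimately show ?thesis unfolding second_countable_def by blast
qed

text \<open>By compactness a clopen set is a finite union of members of a countable base.\<close>

lemma countable_clopen_sets:
  assumes "compact_space X" "second_countable X"
  shows "countable {C. openin X C \<and> closedin X C}"
proof -
  obtain \<B> where B: "countable \<B>" "\<forall>V\<in>\<B>. openin X V"
     "\<forall>U x. openin X U \<and> x \<in> U \<longrightarrow> (\<exists>V\<in>\<B>. x \<in> V \<and> V \<subseteq> U)"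
    using assms(2) unfolding second_countable_def by meson
  have "C \<in> \<Union> ` {F. finite F \<and> F \<subseteq> \<B>}" if C: "openin X C" "closedin X C" for C
  proof -
    have "compactin X C" using C(2) assms(1) by (simp add: closedin_compact_space)
    moreover have "C \<subseteq> \<Union>{V \<in> \<B>. V \<subseteq> C}" using B(3) C(1) by blast
    moreover have "\<forall>V\<in>{V \<in> \<B>. V \<subseteq> C}. openin X V" using B(2) by blast
    ultimately obtain F where "finite F" "F \<subseteq> {V \<in> \<B>. V \<subseteq> C}" "C \<subseteq> \<Union>F"
      unfolding compactin_def by meson
    then have "C = \<Union>F" "F \<subseteq> \<B>" by auto
    then show ?thesis using \<open>finite F\<close> by (intro image_eqI[of _ _ F]) auto
  qed
  then have "{C. openin X C \<and> closedin X C} \<subseteq> \<Union> ` {F. finite F \<and> F \<subseteq> \<B>}" by auto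
  then show ?thesis
    by (rule countable_subset) (intro countable_image countable_Collect_finite_subset B)
qed

lemma clopen_sequence_separating_points:
  assumes "compact_space X" "metrizable_space X" "totally_disconnected_space X"
  obtains Q :: "nat \<Rightarrow> 'a set" where "\<And>j. openin X (Q j)" "\<And>j. closedin X (Q j)"
    "\<And>x y. \<lbrakk>x \<in> topspace X; y \<in> topspace X; x \<noteq> y\<rbrakk> \<Longrightarrow> \<exists>j. x \<in> Q j \<and> y \<notin> Q j"
proof -
  let ?C = "{C. openin X C \<and> closedin X C}"
  have cnt: "countable ?C"
    using assms countable_clopen_sets compact_metrizable_imp_second_countable by blast
  moreover have ne: "?C \<noteq> {}" using openin_empty closedin_empty by blast
  ultimately have r: "range (from_nat_into ?C) = ?C" by simp
  show ?thesis
  proof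
    show "openin X (from_nat_into ?C j)" "closedin X (from_nat_into ?C j)" for j
      using from_nat_into[OF ne, of j] by auto
    fix x y assume "x \<in> topspace X" "y \<in> topspace X" "x \<noteq> y"
    then obtain C where "C \<in> ?C" "x \<in> C" "y \<notin> C"
      using totally_disconnected_compact_clopen_separation[of X x y] assms metrizable_imp_Hausdorff_space
      by blast
    then show "\<exists>j. x \<in> from_nat_into ?C j \<and> y \<notin> from_nat_into ?C j"
      using r by (metis (no_types, lifting) imageE)
  qed
qed

section \<open>Minimal sets and recurrence\<close>

text \<open>Zorn's lemma only has to produce a minimal element among the closed nonempty sets \<open>K\<close> with
  \<open>f ` K \<subseteq> K\<close>: such an element \<open>M\<close> satisfies \<open>f ` M = M\<close>, because \<open>f ` M\<close> belongs to the same family. Starting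
  from one-sided invariance is what makes closures of half-orbits admissible.\<close>

lemma closed_forward_invariant_contains_minimal_set:
  assumes T: "compact_space T" "homeomorphic_map T T f"
    and N: "closedin T N" "N \<noteq> {}" "f ` N \<subseteq> N"
  obtains M where "minimal_set T f M" "M \<subseteq> N"
proof -
  define good where "good K \<longleftrightarrow> closedin T K \<and> K \<noteq> {} \<and> f ` K \<subseteq> K \<and> K \<subseteq> N" for K
  \<comment> \<open>Zorn's lemma yields maximal elements for inclusion, so it is applied to complements.\<close>
  let ?A = "{U. U \<subseteq> topspace T \<and> good (topspace T - U)}"
  have sub: "K \<subseteq> topspace T" if "good K" for K
    using that closedin_subset good_def by blast
  have dd: "topspace T - (topspace T - K) = K" if "good K" for K
    using sub[OF that] by blast
  have "good N" using N good_def by blast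
  then have "topspace T - N \<in> ?A" using dd by auto
  then have "?A \<noteq> {}" by blast
  moreover have "\<Union>\<C> \<in> ?A" if C: "\<C> \<noteq> {}" "subset.chain ?A \<C>" for \<C>
  proof -
    have CA: "U \<subseteq> topspace T" "good (topspace T - U)" if "U \<in> \<C>" for U
      using C(2) that unfolding subset_chain_def by blast+
    have op: "openin T U" if "U \<in> \<C>" for U
      using CA[OF that] unfolding good_def by (simp add: openin_closedin)
    \<comment> \<open>A finite subcover taken from a chain has a largest member, which would already be the whole space.\<close>
    have "\<Union>\<C> \<noteq> topspace T"
    proof
      assume "\<Union>\<C> = topspace T"
      then have "topspace T \<subseteq> \<Union>\<C>" by simp
      then have "\<exists>F. finite F \<and> F \<subseteq> \<C> \<and> topspace T \<subseteq> \<Union>F"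
        using T(1) op unfolding compact_space_def by (intro compactinD)
      then obtain F where F: "finite F" "F \<subseteq> \<C>" "topspace T \<subseteq> \<Union>F" by blast
      obtain U0 where "U0 \<in> \<C>" using C(1) by blast
      then have "topspace T \<noteq> {}" using CA(2) unfolding good_def by blast
      then have "F \<noteq> {}" using F(3) by blast
      moreover have "subset.chain ?A F"
        using C(2) F(2) unfolding subset_chain_def by (meson subset_trans subsetD)
      ultimately have "\<Union>F \<in> F" using F(1) Union_in_chain by blast
      then have "good (topspace T - \<Union>F)" using F(2) CA(2) by blast
      then show False using F(3) unfolding good_def by blast
    qed
    moreover have "\<Union>\<C> \<subseteq> topspace T" using CA(1) by blast
    moreover have "closedin T (topspace T - \<Union>\<C>)" using op by blast
    moreover have "f ` (topspace T - \<Union>\<C>) \<subseteq> topspace T - \<Union>\<C>"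
    proof clarsimp
      fix x assume x: "x \<in> topspace T" "\<forall>U\<in>\<C>. x \<notin> U"
      have "f x \<in> topspace T - U" if "U \<in> \<C>" for U
        using CA(2)[OF that] x that unfolding good_def by blast
      then show "f x \<in> topspace T \<and> (\<forall>U\<in>\<C>. f x \<notin> U)" using C(1) by blast
    qed
    moreover have "topspace T - \<Union>\<C> \<subseteq> N"
      using C(1) CA(2) unfolding good_def by blast
    ultimately show ?thesis unfolding good_def by blast
  qed
  ultimately have "\<exists>U\<in>?A. \<forall>V\<in>?A. U \<subseteq> V \<longrightarrow> V = U" by (rule subset_Zorn_nonempty)
  then obtain U where U: "U \<in> ?A" and Umax: "\<And>V. V \<in> ?A \<Longrightarrow> U \<subseteq> V \<Longrightarrow> V = U" by meson
  define M where "M = topspace T - U"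
  have M: "good M" using U M_def by blast
  have min: "K = M" if "good K" "K \<subseteq> M" for K
  proof -
    have "topspace T - K \<in> ?A" using dd[OF that(1)] that(1) by simp
    moreover have "U \<subseteq> topspace T - K" using U that(2) M_def by blast
    ultimately have "topspace T - K = U" using Umax by blast
    then show ?thesis using dd[OF that(1)] M_def by simp
  qed
  have "closedin T (f ` M)"
    using homeomorphic_imp_closed_map[OF T(2)] M unfolding good_def closed_map_def by simp
  moreover have fM: "f ` M \<subseteq> M" using M good_def by simp
  ultimately have "good (f ` M)" using M image_mono[OF fM, of f] unfolding good_def by auto
  then have "f ` M = M" using fM by (rule min)
  then have "invariant_closed_set T f M" using M unfolding good_def invariant_closed_set_def by simp
  moreover have "\<not> K \<subset> M" if "invariant_closed_set T f K" for K
  proof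
    assume K: "K \<subset> M"
    then have "good K" using that M unfolding good_def invariant_closed_set_def by auto
    then show False using min K by blast
  qed
  ultimately have "minimal_set T f M" unfolding minimal_set_def by blast
  then show ?thesis using M that unfolding good_def by blast
qed

lemma funpow_in_topspace:
  assumes "continuous_map T T f" "x \<in> topspace T"
  shows "(f ^^ k) x \<in> topspace T"
  using assms by (induction k) (auto simp: continuous_map_def)

text \<open>The closure of the forward orbit of \<open>x\<close> contains a minimal set, and \<open>z\<close> lies in all of these.\<close>

lemma orbit_meets_neighbourhood_of_unique_minimal_set:
  assumes T: "compact_space T" "homeomorphic_map T T f"
    and M: "\<And>M'. minimal_set T f M' \<Longrightarrow> z \<in> M'"
    and x: "x \<in> topspace T" and U: "openin T U" "z \<in> U"
  shows "\<exists>k. (f ^^ k) x \<in> U"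
proof -
  let ?O = "range (\<lambda>k. (f ^^ k) x)"
  have c: "continuous_map T T f" using T(2) by (rule homeomorphic_imp_continuous_map)
  have O: "?O \<subseteq> topspace T" using funpow_in_topspace[OF c x] by blast
  have "f ` ?O \<subseteq> ?O"
  proof clarsimp
    fix k show "f ((f ^^ k) x) \<in> ?O" by (rule range_eqI[of _ _ "Suc k"]) simp
  qed
  then have "f ` (T closure_of ?O) \<subseteq> T closure_of ?O"
    by (rule subset_trans[OF continuous_map_image_closure_subset[OF c] closure_of_mono])
  moreover have "T closure_of ?O \<noteq> {}" using closure_of_subset[OF O] by blast
  ultimately obtain M' where "minimal_set T f M'" "M' \<subseteq> T closure_of ?O"
    using closed_forward_invariant_contains_minimal_set[OF T] closedin_closure_of by metis
  then have "z \<in> T closure_of ?O" using M by blast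
  then show ?thesis using U unfolding in_closure_of by blast
qed

lemma minimal_set_inverse:
  assumes "homeomorphic_maps T T f g"
  shows "minimal_set T g M \<longleftrightarrow> minimal_set T f M"
proof -
  have fg: "\<And>x. x \<in> topspace T \<Longrightarrow> g (f x) = x \<and> f (g x) = x"
    using assms unfolding homeomorphic_maps_def by blast
  have "f ` K = K \<longleftrightarrow> g ` K = K" if "K \<subseteq> topspace T" for K
  proof
    assume "f ` K = K"
    then have "g ` K = g ` f ` K" by simp
    also have "\<dots> = K" using fg that by (force simp: image_image)
    finally show "g ` K = K" .
  next
    assume "g ` K = K"
    then have "f ` K = f ` g ` K" by simp
    also have "\<dots> = K" using fg that by (force simp: image_image)
    finally show "f ` K = K" .
  qed
  then have "invariant_closed_set T g K \<longleftrightarrow> invariant_closed_set T f K" for K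
    using closedin_subset unfolding invariant_closed_set_def by blast
  then show ?thesis unfolding minimal_set_def by simp
qed

section \<open>Locally constant functions\<close>

text \<open>Continuity into a discrete space, in a form that makes the closure properties below immediate.\<close>

definition locally_constant :: "'a topology \<Rightarrow> ('a \<Rightarrow> 'b) \<Rightarrow> bool" where
  "locally_constant X f \<longleftrightarrow>
     (\<forall>x\<in>topspace X. \<exists>U. openin X U \<and> x \<in> U \<and> (\<forall>y\<in>U. f y = f x))"

lemma locally_constant_const [simp]: "locally_constant X (\<lambda>_. c)"
  unfolding locally_constant_def by (intro ballI exI[of _ "topspace X"]) simp

text \<open>The basic closure property: a locally constant parameter may select which of a family of locally
  constant functions is evaluated. Return times, base points and itineraries are all of this form.\<close>

lemma locally_constant_bind:
  assumes "locally_constant X k" "\<And>i. locally_constant X (F i)"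
  shows "locally_constant X (\<lambda>x. F (k x) x)"
  unfolding locally_constant_def
proof
  fix x assume x: "x \<in> topspace X"
  obtain U where "openin X U" "x \<in> U" "\<forall>y\<in>U. k y = k x"
    using assms(1) x unfolding locally_constant_def by blast
  moreover obtain V where "openin X V" "x \<in> V" "\<forall>y\<in>V. F (k x) y = F (k x) x"
    using assms(2)[of "k x"] x unfolding locally_constant_def by blast
  ultimately have "openin X (U \<inter> V) \<and> x \<in> U \<inter> V \<and> (\<forall>y\<in>U \<inter> V. F (k y) y = F (k x) x)"
    by (metis IntE IntI openin_Int)
  then show "\<exists>W. openin X W \<and> x \<in> W \<and> (\<forall>y\<in>W. F (k y) y = F (k x) x)" by (rule exI)
qed

lemma locally_constant_comp: "locally_constant X f \<Longrightarrow> locally_constant X (\<lambda>x. \<phi> (f x))"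
  using locally_constant_bind[of X f "\<lambda>i _. \<phi> i"] by simp

lemma locally_constant_comp2:
  "locally_constant X f \<Longrightarrow> locally_constant X g \<Longrightarrow> locally_constant X (\<lambda>x. \<phi> (f x) (g x))"
  using locally_constant_bind[of X f "\<lambda>i x. \<phi> i (g x)"] by (simp add: locally_constant_comp)

lemma locally_constant_precompose:
  assumes "locally_constant X f" "continuous_map X X \<phi>"
  shows "locally_constant X (\<lambda>x. f (\<phi> x))"
  unfolding locally_constant_def
proof
  fix x assume x: "x \<in> topspace X"
  then have "\<phi> x \<in> topspace X" using assms(2) by (auto simp: continuous_map_def)
  then obtain U where U: "openin X U" "\<phi> x \<in> U" "\<forall>y\<in>U. f y = f (\<phi> x)"
    using assms(1) unfolding locally_constant_def by blast
  have "openin X {y \<in> topspace X. \<phi> y \<in> U}" using U(1) assms(2) by (simp add: continuous_map_def)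
  then show "\<exists>W. openin X W \<and> x \<in> W \<and> (\<forall>y\<in>W. f (\<phi> y) = f (\<phi> x))"
    using U(2,3) x by (intro exI[of _ "{y \<in> topspace X. \<phi> y \<in> U}"] conjI ballI) blast+
qed

lemma locally_constant_map_list:
  assumes "\<And>i. locally_constant X (F i)"
  shows "locally_constant X (\<lambda>x. map (\<lambda>i. F i x) [0..<m])"
proof (induction m)
  case (Suc m)
  have "locally_constant X (\<lambda>x. map (\<lambda>i. F i x) [0..<m] @ [F m x])"
    by (rule locally_constant_comp2[OF Suc assms])
  then show ?case by simp
qed simp

lemma locally_constant_Least:
  assumes "\<And>i. locally_constant X (P i)" "\<And>x. x \<in> topspace X \<Longrightarrow> \<exists>i. P i x"
  shows "locally_constant X (\<lambda>x. LEAST i::nat. P i x)"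
  unfolding locally_constant_def
proof
  fix x assume x: "x \<in> topspace X"
  let ?k = "LEAST i. P i x"
  have "locally_constant X (\<lambda>x. map (\<lambda>i. P i x) [0..<Suc ?k])"
    by (rule locally_constant_map_list) (rule assms)
  then obtain U where U: "openin X U" "x \<in> U"
    and eq: "\<forall>y\<in>U. map (\<lambda>i. P i y) [0..<Suc ?k] = map (\<lambda>i. P i x) [0..<Suc ?k]"
    using x unfolding locally_constant_def by blast
  have same: "P i y = P i x" if "y \<in> U" "i \<le> ?k" for i y
    using eq that by (auto simp del: upt_Suc)
  have "(LEAST i. P i y) = ?k" if "y \<in> U" for y
  proof (rule Least_equality)
    show "P ?k y" using same[OF that, of ?k] assms(2)[OF x] by (metis LeastI le_refl)
    show "?k \<le> i" if "P i y" for i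
      using same[OF \<open>y \<in> U\<close>, of i] that by (metis Least_le nle_le)
  qed
  then show "\<exists>U. openin X U \<and> x \<in> U \<and> (\<forall>y\<in>U. (LEAST i. P i y) = ?k)" using U by blast
qed

lemma openin_locally_constant_Collect:
  assumes "locally_constant X f"
  shows "openin X {x \<in> topspace X. f x \<in> S}"
proof (subst openin_subopen, intro ballI)
  fix x assume "x \<in> {x \<in> topspace X. f x \<in> S}"
  then have x: "x \<in> topspace X" "f x \<in> S" by auto
  then obtain U where U: "openin X U" "x \<in> U" "\<forall>y\<in>U. f y = f x"
    using assms unfolding locally_constant_def by blast
  have "y \<in> {x \<in> topspace X. f x \<in> S}" if "y \<in> U" for y
    using that U(3) x(2) openin_subset[OF U(1)] by auto
  then show "\<exists>T. openin X T \<and> x \<in> T \<and> T \<subseteq> {x \<in> topspace X. f x \<in> S}"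
    using U(1,2) by (intro exI[of _ U]) auto
qed

lemma closedin_locally_constant_Collect:
  assumes "locally_constant X f"
  shows "closedin X {x \<in> topspace X. f x \<in> S}"
proof -
  have "{x \<in> topspace X. f x \<in> S} = topspace X - {x \<in> topspace X. f x \<in> - S}" by blast
  then show ?thesis
    using openin_locally_constant_Collect[OF assms, of "- S"] closedin_diff closedin_topspace by metis
qed

lemma locally_constant_mem_clopen:
  assumes "openin X C" "closedin X C"
  shows "locally_constant X (\<lambda>x. x \<in> C)"
  unfolding locally_constant_def
proof
  fix x assume x: "x \<in> topspace X"
  show "\<exists>U. openin X U \<and> x \<in> U \<and> (\<forall>y\<in>U. (y \<in> C) = (x \<in> C))"
  proof (cases "x \<in> C")
    case True then show ?thesis using assms(1) by blast
  next
    case False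
    then have "openin X (topspace X - C) \<and> x \<in> topspace X - C \<and> (\<forall>y\<in>topspace X - C. (y \<in> C) = (x \<in> C))"
      using assms(2) x by blast
    then show ?thesis by blast
  qed
qed

lemma finite_image_locally_constant:
  assumes "compact_space X" "locally_constant X f"
  shows "finite (f ` topspace X)"
proof -
  let ?U = "(\<lambda>c. {x \<in> topspace X. f x \<in> {c}}) ` UNIV"
  have "\<forall>U\<in>?U. openin X U" using openin_locally_constant_Collect[OF assms(2)] by blast
  moreover have "topspace X \<subseteq> \<Union>?U" by auto
  ultimately obtain F where F: "finite F" "F \<subseteq> ?U" "topspace X \<subseteq> \<Union>F"
    using assms(1) unfolding compact_space_def compactin_def by meson
  obtain C where C: "finite C" "F = (\<lambda>c. {x \<in> topspace X. f x \<in> {c}}) ` C"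
    using finite_subset_image[OF F(1,2)] by blast
  have "f ` topspace X \<subseteq> C" using F(3) C(2) by auto
  then show ?thesis using C(1) finite_subset by blast
qed

section \<open>First return times and towers\<close>

text \<open>For a recurrent set \<open>Y\<close>, cut at the visits of its orbit to \<open>Y\<close>, a point \<open>x\<close> sits \<open>floor_time\<close> steps above
  the previous visit \<open>base_point\<close> (which is \<open>x\<close> itself if \<open>x \<in> Y\<close>) and \<open>time_to_top\<close> steps below the last
  floor before the next visit. Here \<open>g\<close> plays the role of the inverse of \<open>h\<close>.\<close>

definition floor_time :: "('a \<Rightarrow> 'a) \<Rightarrow> 'a set \<Rightarrow> 'a \<Rightarrow> nat" where
  "floor_time g Y x = (LEAST k. (g ^^ k) x \<in> Y)"

definition time_to_top :: "('a \<Rightarrow> 'a) \<Rightarrow> 'a set \<Rightarrow> 'a \<Rightarrow> nat" where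
  "time_to_top h Y x = (LEAST k. (h ^^ Suc k) x \<in> Y)"

definition base_point :: "('a \<Rightarrow> 'a) \<Rightarrow> 'a set \<Rightarrow> 'a \<Rightarrow> 'a" where
  "base_point g Y x = (g ^^ floor_time g Y x) x"

locale bijective_dynamics =
  fixes S :: "'a set" and h g :: "'a \<Rightarrow> 'a"
  assumes h_in: "x \<in> S \<Longrightarrow> h x \<in> S" and g_in: "x \<in> S \<Longrightarrow> g x \<in> S"
    and gh: "x \<in> S \<Longrightarrow> g (h x) = x" and hg: "x \<in> S \<Longrightarrow> h (g x) = x"
begin

lemma hpow_in: "x \<in> S \<Longrightarrow> (h ^^ k) x \<in> S"
  by (induction k) (auto simp: h_in)

lemma gpow_in: "x \<in> S \<Longrightarrow> (g ^^ k) x \<in> S"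
  by (induction k) (auto simp: g_in)

lemma gpow_hpow_cancel: "x \<in> S \<Longrightarrow> (g ^^ k) ((h ^^ k) x) = x"
  by (induction k) (auto simp: funpow_swap1[of g] gh hpow_in)

lemma hpow_gpow_cancel: "x \<in> S \<Longrightarrow> (h ^^ k) ((g ^^ k) x) = x"
  by (induction k) (auto simp: funpow_swap1[of h] hg gpow_in)

lemma gpow_hpow: "x \<in> S \<Longrightarrow> k \<le> m \<Longrightarrow> (g ^^ k) ((h ^^ m) x) = (h ^^ (m - k)) x"
  using gpow_hpow_cancel[of "(h ^^ (m - k)) x" k] hpow_in
  by (metis comp_apply funpow_add le_add_diff_inverse)

lemma hpow_gpow: "x \<in> S \<Longrightarrow> m \<le> k \<Longrightarrow> (h ^^ m) ((g ^^ k) x) = (g ^^ (k - m)) x"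
  using hpow_gpow_cancel[of "(g ^^ (k - m)) x" m] gpow_in
  by (metis comp_apply funpow_add le_add_diff_inverse)

lemma hpow_gpow': "x \<in> S \<Longrightarrow> k \<le> m \<Longrightarrow> (h ^^ m) ((g ^^ k) x) = (h ^^ (m - k)) x"
  using hpow_gpow_cancel[of x k] by (metis comp_apply funpow_add le_add_diff_inverse2)

definition recurrent :: "'a set \<Rightarrow> bool" where
  "recurrent Y \<longleftrightarrow> Y \<subseteq> S \<and> (\<forall>x\<in>S. (\<exists>k. (h ^^ Suc k) x \<in> Y) \<and> (\<exists>k. (g ^^ k) x \<in> Y))"

lemma base_point_in:
  assumes "recurrent Y" "x \<in> S"
  shows "base_point g Y x \<in> Y"
  using assms unfolding recurrent_def base_point_def floor_time_def by (metis (lifting) LeastI)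

lemma top_returns:
  assumes "recurrent Y" "x \<in> S"
  shows "(h ^^ Suc (time_to_top h Y x)) x \<in> Y"
  using assms unfolding recurrent_def time_to_top_def by (metis (mono_tags, lifting) LeastI)

lemma not_in_before_top: "k < time_to_top h Y x \<Longrightarrow> (h ^^ Suc k) x \<notin> Y"
  unfolding time_to_top_def using not_less_Least by blast

lemma not_in_below_floor: "k < floor_time g Y x \<Longrightarrow> (g ^^ k) x \<notin> Y"
  unfolding floor_time_def using not_less_Least by blast

lemma floor_time_eqI:
  "(g ^^ k) x \<in> Y \<Longrightarrow> (\<And>j. j < k \<Longrightarrow> (g ^^ j) x \<notin> Y) \<Longrightarrow> floor_time g Y x = k"
  unfolding floor_time_def by (rule Least_equality) (auto intro: leI)

lemma time_to_top_eqI: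
  "(h ^^ Suc k) x \<in> Y \<Longrightarrow> (\<And>j. j < k \<Longrightarrow> (h ^^ Suc j) x \<notin> Y) \<Longrightarrow> time_to_top h Y x = k"
  unfolding time_to_top_def by (rule Least_equality) (auto intro: leI)

lemma hpow_base_point: "x \<in> S \<Longrightarrow> (h ^^ floor_time g Y x) (base_point g Y x) = x"
  unfolding base_point_def by (rule hpow_gpow_cancel)

lemma floor_time_base [simp]: "b \<in> Y \<Longrightarrow> floor_time g Y b = 0"
  by (rule floor_time_eqI) auto

lemma floor_time_0_iff:
  assumes "recurrent Y" "x \<in> S"
  shows "floor_time g Y x = 0 \<longleftrightarrow> x \<in> Y"
  using base_point_in[OF assms] by (auto simp: base_point_def)

lemma base_point_base [simp]: "b \<in> Y \<Longrightarrow> base_point g Y b = b"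
  by (simp add: base_point_def)

lemma time_to_top_0_iff:
  assumes "recurrent Y" "x \<in> S"
  shows "time_to_top h Y x = 0 \<longleftrightarrow> h x \<in> Y"
  using top_returns[OF assms] time_to_top_eqI[of 0 x Y] by auto

text \<open>Coordinates along one passage through a tower: nothing but the floor changes.\<close>

lemma pass:
  assumes Y: "recurrent Y" and b: "b \<in> Y" and k: "k \<le> time_to_top h Y b"
  shows "floor_time g Y ((h ^^ k) b) = k" "base_point g Y ((h ^^ k) b) = b"
    "time_to_top h Y ((h ^^ k) b) = time_to_top h Y b - k"
proof -
  have bS: "b \<in> S" using Y b unfolding recurrent_def by blast
  show fl: "floor_time g Y ((h ^^ k) b) = k"
  proof (rule floor_time_eqI)
    show "(g ^^ k) ((h ^^ k) b) \<in> Y" using gpow_hpow_cancel[OF bS] b by simp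
    fix j assume j: "j < k"
    then have "(g ^^ j) ((h ^^ k) b) = (h ^^ Suc (k - j - 1)) b"
      using gpow_hpow[OF bS, of j k] Suc_diff_Suc[of j k] by (simp del: funpow.simps)
    moreover have "k - j - 1 < time_to_top h Y b" using j k by simp
    ultimately show "(g ^^ j) ((h ^^ k) b) \<notin> Y" using not_in_before_top[of "k - j - 1" Y b] by metis
  qed
  show "base_point g Y ((h ^^ k) b) = b"
    unfolding base_point_def fl by (rule gpow_hpow_cancel[OF bS])
  have add: "(h ^^ Suc j) ((h ^^ k) b) = (h ^^ Suc (j + k)) b" for j
    by (metis add_Suc comp_apply funpow_add)
  show "time_to_top h Y ((h ^^ k) b) = time_to_top h Y b - k"
  proof (rule time_to_top_eqI)
    show "(h ^^ Suc (time_to_top h Y b - k)) ((h ^^ k) b) \<in> Y"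
      using top_returns[OF Y bS] k unfolding add by simp
    fix j assume "j < time_to_top h Y b - k"
    then show "(h ^^ Suc j) ((h ^^ k) b) \<notin> Y"
      unfolding add by (intro not_in_before_top) simp
  qed
qed

lemma time_to_top_base_point:
  assumes Y: "recurrent Y" and x: "x \<in> S"
  shows "time_to_top h Y (base_point g Y x) = floor_time g Y x + time_to_top h Y x"
proof (rule time_to_top_eqI)
  let ?t = "floor_time g Y x"
  show "(h ^^ Suc (?t + time_to_top h Y x)) (base_point g Y x) \<in> Y"
    using top_returns[OF Y x] hpow_gpow'[OF x, of ?t "Suc (?t + time_to_top h Y x)"]
    unfolding base_point_def by (simp del: funpow.simps add: Suc_diff_le)
  fix j assume j: "j < ?t + time_to_top h Y x"
  show "(h ^^ Suc j) (base_point g Y x) \<notin> Y"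
  proof (cases "j < ?t")
    case True
    then have "(h ^^ Suc j) (base_point g Y x) = (g ^^ (?t - Suc j)) x"
      unfolding base_point_def using hpow_gpow[OF x, of "Suc j" ?t] by (simp del: funpow.simps)
    then show ?thesis using not_in_below_floor[of "?t - Suc j" Y x] True by simp
  next
    case False
    then have "(h ^^ Suc j) (base_point g Y x) = (h ^^ Suc (j - ?t)) x"
      unfolding base_point_def using hpow_gpow'[OF x, of ?t "Suc j"]
      by (simp del: funpow.simps add: Suc_diff_le)
    then show ?thesis using not_in_before_top[of "j - ?t" Y x] False j by simp
  qed
qed

lemma floor_time_le: "recurrent Y' \<Longrightarrow> x \<in> S \<Longrightarrow> Y' \<subseteq> Y \<Longrightarrow> floor_time g Y x \<le> floor_time g Y' x"
  using base_point_in[of Y' x] not_in_below_floor[of "floor_time g Y' x" Y x]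
  unfolding base_point_def by (meson leI subsetD)

lemma time_to_top_le: "recurrent Y' \<Longrightarrow> x \<in> S \<Longrightarrow> Y' \<subseteq> Y \<Longrightarrow> time_to_top h Y x \<le> time_to_top h Y' x"
  using top_returns[of Y' x] not_in_before_top[of "time_to_top h Y' x" Y x]
  by (meson leI subsetD)

text \<open>Between two visits to the larger set there is no visit to the smaller one, so during such a passage
  the base point for the smaller set stays fixed and its floor advances in parallel.\<close>

lemma nested_pass:
  assumes Y: "recurrent Y" "recurrent Y'" "Y' \<subseteq> Y" and x: "x \<in> S"
    and k: "k \<le> time_to_top h Y (base_point g Y x)"
  shows "floor_time g Y' ((h ^^ k) (base_point g Y x)) = k + (floor_time g Y' x - floor_time g Y x)"
    "base_point g Y' ((h ^^ k) (base_point g Y x)) = base_point g Y' x"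
proof -
  let ?b = "base_point g Y x" and ?b' = "base_point g Y' x"
  let ?o = "floor_time g Y' x - floor_time g Y x"
  have le: "floor_time g Y x \<le> floor_time g Y' x" using floor_time_le Y x by blast
  have b': "?b' \<in> Y'" "?b' \<in> S" using base_point_in Y(2) x unfolding recurrent_def by blast+
  have b: "?b \<in> S" unfolding base_point_def by (rule gpow_in[OF x])
  have top: "time_to_top h Y' ?b' = floor_time g Y' x + time_to_top h Y' x"
    by (rule time_to_top_base_point[OF Y(2) x])
  have eqb: "(h ^^ ?o) ?b' = ?b"
    unfolding base_point_def using hpow_gpow[OF x, of ?o "floor_time g Y' x"] le by simp
  have o: "?o \<le> time_to_top h Y' ?b'" unfolding top by simp
  have "k \<le> time_to_top h Y' ?b" using k time_to_top_le[OF Y(2) b Y(3)] by simp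
  then have "k + ?o \<le> time_to_top h Y' ?b'"
    using pass(3)[OF Y(2) b'(1) o] o unfolding eqb by linarith
  moreover have "(h ^^ (k + ?o)) ?b' = (h ^^ k) ?b" using eqb by (simp add: funpow_add)
  ultimately show "floor_time g Y' ((h ^^ k) ?b) = k + ?o" "base_point g Y' ((h ^^ k) ?b) = ?b'"
    using pass(1,2)[OF Y(2) b'(1), of "k + ?o"] by metis+
qed

end

section \<open>Coherent sequences of towers\<close>

text \<open>The label of a tower is the label of its base points.\<close>

definition tower_label :: "('a \<Rightarrow> 'a) \<Rightarrow> 'a set \<Rightarrow> ('a \<Rightarrow> 'b) \<Rightarrow> 'a \<Rightarrow> 'b" where
  "tower_label g Y L x = L (base_point g Y x)"

text \<open>The combinatorial data behind the diagram: at level \<open>n\<close> the label and the floor locate a point in a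
  tower over \<open>Y n\<close>. The decisive hypothesis \<open>coherent\<close> says that the towers of level \<open>n + 1\<close> are stacked from
  whole passages through towers of level \<open>n\<close>. At level \<open>0\<close> there is a single tower, of height one.\<close>

locale tower_sequence = bijective_dynamics S h g for S :: "'a set" and h g +
  fixes Y :: "nat \<Rightarrow> 'a set" and L :: "nat \<Rightarrow> 'a \<Rightarrow> nat"
  assumes S_nonempty: "S \<noteq> {}"
    and recurrent_Y: "recurrent (Y n)"
    and Y_0: "Y 0 = S" and Y_Suc: "Y (Suc n) \<subseteq> Y n"
    and L_0: "L 0 x = 0"
    and finite_labels: "finite (L n ` S)"
    and same_height: "\<lbrakk>x \<in> S; x' \<in> S; tower_label g (Y n) (L n) x = tower_label g (Y n) (L n) x'\<rbrakk> \<Longrightarrow>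
        floor_time g (Y n) x + time_to_top h (Y n) x = floor_time g (Y n) x' + time_to_top h (Y n) x'"
    and coherent: "\<lbrakk>x \<in> S; x' \<in> S;
        tower_label g (Y (Suc n)) (L (Suc n)) x = tower_label g (Y (Suc n)) (L (Suc n)) x';
        floor_time g (Y (Suc n)) x = floor_time g (Y (Suc n)) x'\<rbrakk> \<Longrightarrow>
        floor_time g (Y n) x = floor_time g (Y n) x' \<and>
        tower_label g (Y n) (L n) x = tower_label g (Y n) (L n) x'"
begin

text \<open>Short names for level \<open>n\<close>: \<open>t\<close> is the time since the last visit to the base, \<open>r\<close> the remaining time to the
  top floor, \<open>b\<close> the base point and \<open>l\<close> the label; the height of the tower is \<open>t + r + 1\<close>.\<close>

definition t :: "nat \<Rightarrow> 'a \<Rightarrow> nat" where "t n = floor_time g (Y n)"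
definition r :: "nat \<Rightarrow> 'a \<Rightarrow> nat" where "r n = time_to_top h (Y n)"
definition b :: "nat \<Rightarrow> 'a \<Rightarrow> 'a" where "b n = base_point g (Y n)"
definition l :: "nat \<Rightarrow> 'a \<Rightarrow> nat" where "l n = tower_label g (Y n) (L n)"

lemma Y_sub: "Y n \<subseteq> S"
  using recurrent_Y unfolding recurrent_def by blast

lemma b_in_Y: "x \<in> S \<Longrightarrow> b n x \<in> Y n"
  unfolding b_def using base_point_in[OF recurrent_Y] .

lemma b_in: "x \<in> S \<Longrightarrow> b n x \<in> S"
  using b_in_Y Y_sub by blast

lemma t_0: "x \<in> S \<Longrightarrow> t 0 x = 0"
  using floor_time_base[of x "Y 0"] unfolding t_def Y_0 by simp

lemma r_0: "x \<in> S \<Longrightarrow> r 0 x = 0"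
  using time_to_top_0_iff[OF recurrent_Y[of 0], of x] h_in unfolding r_def Y_0 by simp

lemma l_0: "l 0 x = 0"
  unfolding l_def tower_label_def by (rule L_0)

lemma t_Suc: "x \<in> S \<Longrightarrow> t n x \<le> t (Suc n) x"
  unfolding t_def by (rule floor_time_le[OF recurrent_Y _ Y_Suc])

lemma r_Suc: "x \<in> S \<Longrightarrow> r n x \<le> r (Suc n) x"
  unfolding r_def by (rule time_to_top_le[OF recurrent_Y _ Y_Suc])

lemma Y_antimono: "n \<le> m \<Longrightarrow> Y m \<subseteq> Y n"
  by (rule lift_Suc_antimono_le[of Y]) (use Y_Suc in auto)

lemma r_mono: "x \<in> S \<Longrightarrow> n \<le> m \<Longrightarrow> r n x \<le> r m x"
  unfolding r_def by (rule time_to_top_le[OF recurrent_Y _ Y_antimono])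

lemma t_eq_0_iff: "x \<in> S \<Longrightarrow> t n x = 0 \<longleftrightarrow> x \<in> Y n"
  unfolding t_def by (rule floor_time_0_iff[OF recurrent_Y])

lemma r_eq_0_iff: "x \<in> S \<Longrightarrow> r n x = 0 \<longleftrightarrow> h x \<in> Y n"
  unfolding r_def by (rule time_to_top_0_iff[OF recurrent_Y])

lemma r_b: "x \<in> S \<Longrightarrow> r n (b n x) = t n x + r n x"
  unfolding r_def b_def t_def by (rule time_to_top_base_point[OF recurrent_Y])

lemma hpow_b: "x \<in> S \<Longrightarrow> (h ^^ t n x) (b n x) = x"
  unfolding b_def t_def by (rule hpow_base_point)

lemma same_tower:
  assumes x: "x \<in> S" and k: "k \<le> t n x + r n x"
  shows "(h ^^ k) (b n x) \<in> S" "t n ((h ^^ k) (b n x)) = k" "b n ((h ^^ k) (b n x)) = b n x"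
    "l n ((h ^^ k) (b n x)) = l n x" "r n ((h ^^ k) (b n x)) = t n x + r n x - k"
proof -
  have k': "k \<le> r n (b n x)" using k r_b[OF x] by simp
  note p = pass[OF recurrent_Y b_in_Y[OF x] k'[unfolded r_def], folded t_def b_def r_def]
  show "(h ^^ k) (b n x) \<in> S" using b_in[OF x] hpow_in by blast
  show "t n ((h ^^ k) (b n x)) = k" "b n ((h ^^ k) (b n x)) = b n x" using p by auto
  show "r n ((h ^^ k) (b n x)) = t n x + r n x - k" using p(3) r_b[OF x] by simp
  show "l n ((h ^^ k) (b n x)) = l n x" unfolding l_def tower_label_def using p(2) unfolding b_def by simp
qed

text \<open>The floor, in the tower of level \<open>n + 1\<close>, at which the current passage through a tower of level \<open>n\<close>
  starts. Offsets will distinguish and order the edges into a vertex.\<close>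

definition offset :: "nat \<Rightarrow> 'a \<Rightarrow> nat" where "offset n x = t (Suc n) x - t n x"

lemma offset_t: "x \<in> S \<Longrightarrow> t (Suc n) x = offset n x + t n x"
  unfolding offset_def using t_Suc by simp

lemma same_tower_Suc:
  assumes x: "x \<in> S" and k: "k \<le> t n x + r n x"
  shows "t (Suc n) ((h ^^ k) (b n x)) = k + offset n x" "l (Suc n) ((h ^^ k) (b n x)) = l (Suc n) x"
    "offset n ((h ^^ k) (b n x)) = offset n x"
proof -
  have "k \<le> r n (b n x)" using k r_b[OF x] by simp
  note p = nested_pass[OF recurrent_Y recurrent_Y Y_Suc x this[unfolded r_def b_def], folded t_def b_def]
  show t': "t (Suc n) ((h ^^ k) (b n x)) = k + offset n x" using p(1) unfolding offset_def .
  show "l (Suc n) ((h ^^ k) (b n x)) = l (Suc n) x"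
    unfolding l_def tower_label_def using p(2) unfolding b_def by simp
  show "offset n ((h ^^ k) (b n x)) = offset n x"
    unfolding offset_def[of n "(h ^^ k) (b n x)"] t' using same_tower(2)[OF x k] by simp
qed

lemma base_Suc:
  assumes "x \<in> S"
  shows "t (Suc n) (b n x) = offset n x" "l (Suc n) (b n x) = l (Suc n) x" "t n (b n x) = 0" "l n (b n x) = l n x"
  using same_tower_Suc[OF assms, of 0 n] same_tower[OF assms, of 0 n] by auto

lemma coherent_Suc:
  assumes "x \<in> S" "x' \<in> S" "l (Suc n) x = l (Suc n) x'" "t (Suc n) x = t (Suc n) x'"
  shows "t n x = t n x'" "l n x = l n x'"
  using coherent[OF assms(1,2), of n] assms(3,4) unfolding l_def t_def by simp_all

lemma coherent_le:
  assumes "n \<le> N" "x \<in> S" "x' \<in> S" "l N x = l N x'" "t N x = t N x'"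
  shows "t n x = t n x' \<and> l n x = l n x'"
  using assms(1)
proof (induction rule: inc_induct)
  case base
  then show ?case using assms by simp
next
  case (step n)
  then show ?case using coherent_Suc[OF assms(2,3), of n] by blast
qed

text \<open>This makes the source of an edge well defined: the label and the offset determine the floor of the
  base point of level \<open>n\<close> in the tower of level \<open>n + 1\<close>, to which coherence applies.\<close>

lemma offset_label:
  assumes "x \<in> S" "x' \<in> S" "l (Suc n) x = l (Suc n) x'" "offset n x = offset n x'"
  shows "l n x = l n x'"
  using coherent_Suc(2)[of "b n x" "b n x'" n] base_Suc[OF assms(1), of n] base_Suc[OF assms(2), of n]
    assms b_in by metis

lemma height_eq:
  assumes "x \<in> S" "x' \<in> S" "l n x = l n x'"
  shows "t n x + r n x = t n x' + r n x'"
  using same_height assms unfolding l_def t_def r_def by blast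

text \<open>The offset is the time of the latest visit to \<open>Y n\<close>. By coherence the visit times are the same for all
  points with the same label, so a visit time of \<open>x'\<close> is one of \<open>x\<close> as well.\<close>

lemma offset_le_of_visit:
  assumes x: "x \<in> S" "x' \<in> S" "l (Suc n) x = l (Suc n) x'" and le: "offset n x' \<le> t (Suc n) x"
  shows "offset n x' \<le> offset n x"
proof -
  \<comment> \<open>The point on the orbit of \<open>x\<close> at the floor where the passage of \<open>x'\<close> starts.\<close>
  let ?p = "(h ^^ offset n x') (b (Suc n) x)"
  note p = same_tower[OF x(1), of "offset n x'" "Suc n"]
  have "t n ?p = t n (b n x')"
    using coherent_Suc(1)[of ?p "b n x'" n] p le b_in[OF x(2)] base_Suc[OF x(2)] x(3) by simp
  then have "?p \<in> Y n" using base_Suc(3)[OF x(2)] t_eq_0_iff p le by simp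
  moreover have "?p = (g ^^ (t (Suc n) x - offset n x')) x"
    using hpow_gpow[OF x(1) le] unfolding b_def t_def base_point_def .
  ultimately have "t n x \<le> t (Suc n) x - offset n x'"
    using not_in_below_floor[of _ "Y n" x] unfolding t_def by (metis not_le)
  then show ?thesis using le unfolding offset_def by linarith
qed

lemma next_visit:
  assumes x: "x \<in> S" and lt: "r n x < r (Suc n) x"
  defines "y \<equiv> (h ^^ Suc (r n x)) x"
  shows "y \<in> S" "l (Suc n) y = l (Suc n) x" "offset n y = Suc (t (Suc n) x + r n x)" "t n y = 0"
proof -
  let ?k = "Suc (t (Suc n) x + r n x)"
  have "y = (h ^^ Suc (r n x)) ((h ^^ t (Suc n) x) (b (Suc n) x))" using hpow_b[OF x] y_def by simp
  then have y: "y = (h ^^ ?k) (b (Suc n) x)"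
    by (metis add.commute add_Suc_right comp_apply funpow_add)
  note p = same_tower[OF x, of ?k "Suc n"]
  show yS: "y \<in> S" and "l (Suc n) y = l (Suc n) x" using p lt y by auto
  have "y \<in> Y n" using top_returns[OF recurrent_Y x] unfolding y_def r_def .
  then show ty: "t n y = 0" using t_eq_0_iff yS by blast
  show "offset n y = ?k" unfolding offset_def ty using p lt y by simp
qed

lemma step_inside:
  assumes x: "x \<in> S" and r: "r n x > 0"
  shows "t n (h x) = Suc (t n x)" "l n (h x) = l n x"
proof -
  have "h x = (h ^^ Suc (t n x)) (b n x)" using hpow_b[OF x, of n] by simp
  then show "t n (h x) = Suc (t n x)" "l n (h x) = l n x"
    using same_tower[OF x, of "Suc (t n x)" n] r by auto
qed

lemma last_visit_greatest:
  assumes x: "x \<in> S" "x' \<in> S" "l (Suc n) x' = l (Suc n) x" and r: "r n x = r (Suc n) x"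
  shows "offset n x' \<le> offset n x"
proof -
  let ?y = "(h ^^ (t n x + r n x)) (b n x)"
  have y: "?y \<in> S" "t (Suc n) ?y = t n x + r n x + offset n x" "l (Suc n) ?y = l (Suc n) x"
    "offset n ?y = offset n x"
    using same_tower[OF x(1), of "t n x + r n x" n] same_tower_Suc[OF x(1), of "t n x + r n x" n] by auto
  have "offset n x' \<le> t (Suc n) x'" unfolding offset_def by simp
  also have "\<dots> \<le> t (Suc n) x + r (Suc n) x" using height_eq[OF x(2,1,3)] by simp
  also have "\<dots> = t (Suc n) ?y" using y(2) r offset_t[OF x(1), of n] by simp
  finally show ?thesis using offset_le_of_visit[OF y(1) x(2), of n] y x(3) by simp
qed

end

section \<open>The ordered Bratteli diagram of a tower sequence\<close>

context tower_sequence
begin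

definition vertex :: "nat \<Rightarrow> 'a \<Rightarrow> nat" where
  "vertex n x = prod_encode (n, l n x)"

text \<open>An edge of level \<open>n \<ge> 1\<close> is a visit of a tower of level \<open>n\<close> to \<open>Y (n - 1)\<close>. The level is part of the code
  so that different levels are disjoint.\<close>

definition edge :: "nat \<Rightarrow> 'a \<Rightarrow> nat" where
  "edge n x = prod_encode (n, prod_encode (l n x, offset (n - 1) x))"

definition edge_level :: "nat \<Rightarrow> nat" where "edge_level e = fst (prod_decode e)"
definition edge_label :: "nat \<Rightarrow> nat" where "edge_label e = fst (prod_decode (snd (prod_decode e)))"
definition edge_offset :: "nat \<Rightarrow> nat" where "edge_offset e = snd (prod_decode (snd (prod_decode e)))"

text \<open>The source is read off from an arbitrary point passing along the edge; \<open>src_edge\<close> shows that the choice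
  does not matter.\<close>

definition B :: "(nat, nat) bratteli" where
  "B = \<lparr>Vlevel = (\<lambda>n. vertex n ` S), Elevel = (\<lambda>n. edge n ` S),
    src = (\<lambda>e. vertex (edge_level e - 1) (SOME x. x \<in> S \<and> edge (edge_level e) x = e)),
    rng = (\<lambda>e. prod_encode (edge_level e, edge_label e)),
    ord = {(e, e'). \<exists>n x x'. x \<in> S \<and> x' \<in> S \<and> e = edge (Suc n) x \<and> e' = edge (Suc n) x' \<and>
             l (Suc n) x = l (Suc n) x' \<and> offset n x \<le> offset n x'}\<rparr>"

lemma vertex_eq_iff [simp]: "vertex n x = vertex m y \<longleftrightarrow> n = m \<and> l n x = l m y"
  unfolding vertex_def by simp

lemma edge_eq_iff [simp]:
  "edge n x = edge m y \<longleftrightarrow> n = m \<and> l n x = l m y \<and> offset (n - 1) x = offset (m - 1) y"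
  unfolding edge_def by simp

lemma Vlevel_B [simp]: "Vlevel B n = vertex n ` S" and Elevel_B [simp]: "Elevel B n = edge n ` S"
  by (simp_all add: B_def)

lemma rng_edge [simp]: "rng B (edge n x) = vertex n x"
  by (simp add: B_def edge_def edge_level_def edge_label_def vertex_def)

lemma src_edge [simp]:
  assumes "x \<in> S"
  shows "src B (edge (Suc n) x) = vertex n x"
proof -
  let ?P = "\<lambda>y. y \<in> S \<and> edge (Suc n) y = edge (Suc n) x"
  have "?P (SOME y. ?P y)" by (rule someI[of ?P x]) (use assms in simp)
  then have "l n (SOME y. ?P y) = l n x"
    using offset_label[OF _ assms, of "SOME y. ?P y" n] by simp
  then show ?thesis by (simp add: B_def edge_level_def) (simp add: edge_def)
qed

lemma ord_edge [simp]:
  assumes "x \<in> S" "x' \<in> S"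
  shows "(edge (Suc n) x, edge (Suc m) x') \<in> ord B \<longleftrightarrow>
     n = m \<and> l (Suc n) x = l (Suc n) x' \<and> offset n x \<le> offset n x'"
  using assms by (auto simp: B_def)

lemma ord_B_sub: "ord B \<subseteq> {(e, e'). \<exists>n x x'. x \<in> S \<and> x' \<in> S \<and> e = edge (Suc n) x \<and> e' = edge (Suc n) x'}"
  by (auto simp: B_def)

lemma edges_B: "edges B = {edge (Suc n) x |n x. x \<in> S}"
proof -
  have "edges B = (\<Union>n\<in>range Suc. edge n ` S)"
    unfolding edges_def Elevel_B by (metis atLeast_Suc_greaterThan greaterThan_0 One_nat_def)
  then show ?thesis by auto
qed

lemma edge_in_edges [simp]: "x \<in> S \<Longrightarrow> edge (Suc n) x \<in> edges B"
  unfolding edges_B by blast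

lemma verts_B: "verts B = {vertex n x |n x. x \<in> S}"
  unfolding verts_def by auto

lemma finite_l: "finite (l n ` S)"
proof (rule finite_subset[OF _ finite_labels])
  show "l n ` S \<subseteq> L n ` S" unfolding l_def tower_label_def using b_in unfolding b_def by blast
qed

lemma finite_edge: "finite (edge (Suc n) ` S)"
proof -
  \<comment> \<open>The height of a tower depends on its label alone, so it bounds the offsets of all edges into it.\<close>
  define H where "H = (\<lambda>c. let x = (SOME x. x \<in> S \<and> l (Suc n) x = c) in t (Suc n) x + r (Suc n) x)"
  have "edge (Suc n) x \<in> (\<Union>c \<in> l (Suc n) ` S. (\<lambda>k. prod_encode (Suc n, prod_encode (c, k))) ` {..H c})"
    if x: "x \<in> S" for x
  proof -
    let ?P = "\<lambda>y. y \<in> S \<and> l (Suc n) y = l (Suc n) x"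
    have "?P (SOME y. ?P y)" by (rule someI[of ?P x]) (use x in simp)
    then have "t (Suc n) x + r (Suc n) x = H (l (Suc n) x)"
      using height_eq[OF x, of "SOME y. ?P y" "Suc n"] unfolding H_def Let_def by simp
    moreover have "offset n x \<le> t (Suc n) x" unfolding offset_def by simp
    ultimately have "offset n x \<le> H (l (Suc n) x)" by linarith
    then show ?thesis using x by (auto simp: edge_def)
  qed
  then have "edge (Suc n) ` S \<subseteq> (\<Union>c \<in> l (Suc n) ` S. (\<lambda>k. prod_encode (Suc n, prod_encode (c, k))) ` {..H c})"
    by blast
  then show ?thesis by (rule finite_subset) (intro finite_UN_I finite_l finite_imageI finite_atMost)
qed

lemma bratteli_diagram_B: "bratteli_diagram B"
  unfolding bratteli_diagram_def
proof (intro conjI)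
  show "disjoint_family (Vlevel B)" "disjoint_family_on (Elevel B) {1..}"
    unfolding disjoint_family_on_def by auto
  obtain x where x: "x \<in> S" using S_nonempty by blast
  have "Vlevel B 0 = {vertex 0 x}" using x by (auto simp: l_0)
  then show "\<exists>v. Vlevel B 0 = {v}" by blast
  have "vertex n ` S = (\<lambda>c. prod_encode (n, c)) ` l n ` S" for n by (auto simp: vertex_def)
  then show "\<forall>n. finite (Vlevel B n) \<and> Vlevel B n \<noteq> {}" using S_nonempty finite_l by simp
  have "finite (edge n ` S)" if "n \<ge> 1" for n using finite_edge[of "n - 1"] that by simp
  then show "\<forall>n\<ge>1. finite (Elevel B n) \<and> Elevel B n \<noteq> {}" using S_nonempty by simp
  show "\<forall>n\<ge>1. \<forall>e\<in>Elevel B n. src B e \<in> Vlevel B (n - 1) \<and> rng B e \<in> Vlevel B n"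
  proof (intro allI impI)
    fix n :: nat assume "n \<ge> 1"
    then obtain m where "n = Suc m" by (cases n) auto
    then show "\<forall>e\<in>Elevel B n. src B e \<in> Vlevel B (n - 1) \<and> rng B e \<in> Vlevel B n" by auto
  qed
  show "\<forall>v\<in>verts B. {e \<in> edges B. src B e = v} \<noteq> {}"
  proof
    fix v assume "v \<in> verts B"
    then obtain n x where "x \<in> S" "v = vertex n x" unfolding verts_B by blast
    then have "edge (Suc n) x \<in> {e \<in> edges B. src B e = v}" by simp
    then show "{e \<in> edges B. src B e = v} \<noteq> {}" by blast
  qed
  show "\<forall>v\<in>verts B - Vlevel B 0. {e \<in> edges B. rng B e = v} \<noteq> {}"
  proof
    fix v assume v: "v \<in> verts B - Vlevel B 0"
    then obtain n x where nx: "x \<in> S" "v = vertex n x" unfolding verts_B by blast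
    with v obtain m where "n = Suc m" by (cases n) auto
    then have "edge (Suc m) x \<in> {e \<in> edges B. rng B e = v}" using nx by simp
    then show "{e \<in> edges B. rng B e = v} \<noteq> {}" by blast
  qed
qed

lemma ordered_bratteli_diagram_B: "ordered_bratteli_diagram B"
  unfolding ordered_bratteli_diagram_def
proof (intro conjI bratteli_diagram_B)
  have sub: "ord B \<subseteq> edges B \<times> edges B" using ord_B_sub edges_B by blast
  show "partial_order_on (edges B) (ord B)"
    unfolding partial_order_on_def preorder_on_def
  proof (intro conjI sub)
    show "refl_on (edges B) (ord B)" unfolding refl_on_def edges_B by auto
    show "trans (ord B)"
    proof (rule transI)
      fix a c d assume "(a, c) \<in> ord B" "(c, d) \<in> ord B"
      moreover from this sub obtain n x m y k z where "a = edge (Suc n) x" "c = edge (Suc m) y"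
        "d = edge (Suc k) z" "x \<in> S" "y \<in> S" "z \<in> S" unfolding edges_B by blast
      ultimately show "(a, d) \<in> ord B" by auto
    qed
    show "antisym (ord B)"
    proof (rule antisymI)
      fix a c assume "(a, c) \<in> ord B" "(c, a) \<in> ord B"
      moreover from this sub obtain n x m y where "a = edge (Suc n) x" "c = edge (Suc m) y"
        "x \<in> S" "y \<in> S" unfolding edges_B by blast
      ultimately show "a = c" by auto
    qed
  qed
  show "\<forall>e\<in>edges B. \<forall>e'\<in>edges B. ((e, e') \<in> ord B \<or> (e', e) \<in> ord B) \<longleftrightarrow> rng B e = rng B e'"
    unfolding edges_B by auto
qed

text \<open>The tower starts with a visit, since \<open>Y (Suc n) \<subseteq> Y n\<close>.\<close>

lemma edge_in_Emin_iff:
  assumes x: "x \<in> S"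
  shows "edge (Suc n) x \<in> Emin B \<longleftrightarrow> offset n x = 0"
proof
  assume "edge (Suc n) x \<in> Emin B"
  moreover have b: "b (Suc n) x \<in> S" "l (Suc n) (b (Suc n) x) = l (Suc n) x" "offset n (b (Suc n) x) = 0"
    using b_in[OF x] base_Suc(3,4)[OF x, of "Suc n"] by (auto simp: offset_def)
  moreover have "(edge (Suc n) (b (Suc n) x), edge (Suc n) x) \<in> ord B" using x b by simp
  ultimately have "edge (Suc n) (b (Suc n) x) = edge (Suc n) x" unfolding Emin_def by auto
  then show "offset n x = 0" using b by simp
next
  assume "offset n x = 0"
  then show "edge (Suc n) x \<in> Emin B" unfolding Emin_def edges_B using x by auto
qed

text \<open>The right-hand side says that the next visit to \<open>Y n\<close> is already a visit to \<open>Y (Suc n)\<close>; otherwise that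
  visit is a larger edge.\<close>

lemma edge_in_Emax_iff:
  assumes x: "x \<in> S"
  shows "edge (Suc n) x \<in> Emax B \<longleftrightarrow> r n x = r (Suc n) x"
proof
  assume mx: "edge (Suc n) x \<in> Emax B"
  show "r n x = r (Suc n) x"
  proof (rule ccontr)
    assume "r n x \<noteq> r (Suc n) x"
    then have lt: "r n x < r (Suc n) x" using r_Suc[OF x, of n] by simp
    let ?y = "(h ^^ Suc (r n x)) x"
    note y = next_visit[OF x lt]
    have "offset n x < offset n ?y" using y(3) by (simp add: offset_def[of n x])
    moreover from this have "(edge (Suc n) x, edge (Suc n) ?y) \<in> ord B" using x y(1,2) by simp
    ultimately show False using mx y(1) edge_in_edges[OF y(1), of n] unfolding Emax_def by force
  qed
next
  assume r: "r n x = r (Suc n) x"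
  show "edge (Suc n) x \<in> Emax B"
    unfolding Emax_def edges_B using x last_visit_greatest[OF x _ _ r] by force
qed

lemma is_successor_next_visit:
  assumes x: "x \<in> S" and lt: "r n x < r (Suc n) x"
  shows "is_successor B (edge (Suc n) x) (edge (Suc n) ((h ^^ Suc (r n x)) x))"
proof -
  let ?y = "(h ^^ Suc (r n x)) x"
  note y = next_visit[OF x lt]
  have lt': "offset n x < offset n ?y" using y(3) by (simp add: offset_def[of n x])
  have "(edge (Suc n) ?y, f) \<in> ord B"
    if f: "f \<in> edges B" "f \<noteq> edge (Suc n) x" "(edge (Suc n) x, f) \<in> ord B" for f
  proof -
    obtain m z where z: "f = edge (Suc m) z" "z \<in> S" using f(1) unfolding edges_B by blast
    then have m: "m = n" "l (Suc n) z = l (Suc n) x" "offset n x < offset n z" using f x by auto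
    have "offset n ?y \<le> offset n z"
    proof (rule ccontr)
      assume "\<not> offset n ?y \<le> offset n z"
      then have le: "offset n z \<le> t (Suc n) x + r n x" using y(3) by simp
      \<comment> \<open>The last point of the current passage: a visit up to its floor is not later than the current one.\<close>
      let ?k = "t n x + r n x"
      let ?w = "(h ^^ ?k) (b n x)"
      have w: "?w \<in> S" "t (Suc n) ?w = ?k + offset n x" "l (Suc n) ?w = l (Suc n) x" "offset n ?w = offset n x"
        using same_tower[OF x, of ?k n] same_tower_Suc[OF x, of ?k n] by auto
      have "offset n z \<le> t (Suc n) ?w" using le w(2) offset_t[OF x, of n] by simp
      then have "offset n z \<le> offset n ?w" using offset_le_of_visit[OF w(1) z(2), of n] w m by simp
      then show False using w m by simp
    qed
    then show ?thesis using z m y by simp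
  qed
  moreover have "(edge (Suc n) x, edge (Suc n) ?y) \<in> ord B" using x y(1,2) lt' by simp
  moreover have "edge (Suc n) ?y \<in> edges B" using y(1) by (rule edge_in_edges)
  moreover have "edge (Suc n) ?y \<noteq> edge (Suc n) x" using lt' by simp
  ultimately show ?thesis unfolding is_successor_def by blast
qed

end

section \<open>Ranges of vertices on marked paths\<close>

lemma R_iter_0 [simp]: "R_iter B 0 W = W" and S_iter_0 [simp]: "S_iter B 0 W = W"
  by (simp_all add: R_iter_def S_iter_def)

lemma R_iter_Suc: "R_iter B (Suc m) W = (\<Union>v\<in>R_iter B m W. R_of B v)"
  by (simp add: R_iter_def)

lemma S_iter_Suc: "S_iter B (Suc m) W = (\<Union>v\<in>S_iter B m W. S_of B v)"
  by (simp add: S_iter_def)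

lemma R_iter_Suc_inner: "R_iter B (Suc m) W = R_iter B m (\<Union>v\<in>W. R_of B v)"
  unfolding R_iter_def funpow_Suc_right by simp

lemma R_iter_eq_UN: "R_iter B m W = (\<Union>v\<in>W. R_iter B m {v})"
  by (induction m) (auto simp: R_iter_Suc)

lemma S_iter_eq_UN: "S_iter B m W = (\<Union>v\<in>W. S_iter B m {v})"
  by (induction m) (auto simp: S_iter_Suc)

text \<open>Both sides say that some path of length \<open>m\<close> leads from \<open>a\<close> to \<open>u\<close>.\<close>

lemma S_iter_iff_R_iter: "a \<in> S_iter B m {u} \<longleftrightarrow> u \<in> R_iter B m {a}"
proof (induction m arbitrary: a)
  case (Suc m)
  have "a \<in> S_iter B (Suc m) {u} \<longleftrightarrow> (\<exists>c. c \<in> S_iter B m {u} \<and> a \<in> S_of B c)"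
    by (auto simp: S_iter_Suc)
  also have "\<dots> \<longleftrightarrow> (\<exists>c. u \<in> R_iter B m {c} \<and> c \<in> R_of B a)"
    unfolding Suc S_of_def R_of_def by blast
  also have "\<dots> \<longleftrightarrow> u \<in> R_iter B (Suc m) {a}"
    unfolding R_iter_Suc_inner by (subst R_iter_eq_UN) auto
  finally show ?case .
qed auto

context tower_sequence
begin

lemma R_of_vertex:
  "u \<in> R_of B (vertex n x) \<longleftrightarrow> (\<exists>p\<in>S. u = vertex (Suc n) p \<and> l n p = l n x)"
proof
  assume "u \<in> R_of B (vertex n x)"
  then obtain e where e: "e \<in> edges B" "src B e = vertex n x" "u = rng B e" unfolding R_of_def by blast
  then obtain k p where "e = edge (Suc k) p" "p \<in> S" unfolding edges_B by blast
  then show "\<exists>p\<in>S. u = vertex (Suc n) p \<and> l n p = l n x" using e by auto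
next
  assume "\<exists>p\<in>S. u = vertex (Suc n) p \<and> l n p = l n x"
  then obtain p where p: "p \<in> S" "u = vertex (Suc n) p" "l n p = l n x" by blast
  then show "u \<in> R_of B (vertex n x)"
    unfolding R_of_def by (intro image_eqI[of _ _ "edge (Suc n) p"]) auto
qed

text \<open>The path is the one followed by the point \<open>x\<close> itself.\<close>

lemma vertex_in_R_iter: "x \<in> S \<Longrightarrow> vertex (n + m) x \<in> R_iter B m {vertex n x}"
proof (induction m)
  case (Suc m)
  then have "vertex (n + Suc m) x \<in> R_of B (vertex (n + m) x)" by (auto simp: R_of_vertex)
  then show ?case using Suc unfolding R_iter_Suc by blast
qed simp

text \<open>Conditions (b), (c) and (d) for minimal and for maximal edges have a common proof. Here \<open>M\<close> is the set of
  extremal edges and \<open>q\<close> a retraction of the space onto the points with extremal paths: \<open>q = \<psi>\<close> for minimal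
  edges and \<open>q = h\<inverse> \<circ> \<psi>\<close> for maximal ones. A vertex at level \<open>n\<close> knows the level \<open>n\<close> vertex of \<open>q x\<close> for its
  points \<open>x\<close>, and so does every vertex of higher level. All vertices joined by paths therefore agree on
  that marked vertex; and a vertex of level above \<open>n\<close> is connected to the marked vertex that it knows
  (\<open>q_visited\<close>). So for marked \<open>v\<close> the set \<open>R\<^sup>m(v)\<close> consists of all vertices of level \<open>n + m\<close> that know \<open>v\<close>,
  and it is closed under \<open>R\<^sup>m \<circ> S\<^sup>m\<close>.\<close>

lemma marked_vertices:
  fixes q :: "'a \<Rightarrow> 'a" and M :: "nat set"
  assumes q_in: "\<And>x. x \<in> S \<Longrightarrow> q x \<in> S" and q_q: "\<And>x. x \<in> S \<Longrightarrow> q (q x) = q x"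
    and q_label: "\<And>n x x'. \<lbrakk>x \<in> S; x' \<in> S; l n x = l n x'\<rbrakk> \<Longrightarrow> l n (q x) = l n (q x') \<and> t n (q x) = t n (q x')"
    and M_sub: "M \<subseteq> edges B"
    and M_label: "\<And>n x. \<lbrakk>x \<in> S; edge (Suc n) x \<in> M\<rbrakk> \<Longrightarrow> l n x = l n (q x)"
    and M_q: "\<And>n x. x \<in> S \<Longrightarrow> edge (Suc n) (q x) \<in> M"
    and q_visited: "\<And>n N x. \<lbrakk>x \<in> S; n < N\<rbrakk> \<Longrightarrow> \<exists>y\<in>S. l N y = l N x \<and> l n y = l n (q x)"
  defines "VM \<equiv> {v \<in> verts B. \<exists>e\<in>M. src B e = v}"
  shows "\<forall>v\<in>VM. \<exists>v'\<in>VM. \<exists>e\<in>M. src B e = v \<and> rng B e = v'"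
    and "\<forall>v\<in>VM. \<forall>e\<in>M. rng B e \<in> R_of B v \<longrightarrow> src B e = v"
    and "\<forall>v\<in>VM. \<forall>m>0. R_iter B m {v} = (R_iter B m \<circ> S_iter B m \<circ> R_iter B m) {v}"
proof -
  have VM: "\<exists>n x. x \<in> S \<and> v = vertex n (q x)" if v: "v \<in> VM" for v
  proof -
    obtain e where e: "e \<in> M" "src B e = v" using v unfolding VM_def by blast
    then obtain n x where x: "e = edge (Suc n) x" "x \<in> S" using M_sub unfolding edges_B by blast
    then have "v = vertex n (q x)" using e M_label[of x n] by auto
    then show ?thesis using x by blast
  qed
  have q_label_le: "l n (q x) = l n (q x')"
    if "x \<in> S" "x' \<in> S" "l N x = l N x'" "n \<le> N" for n N x x'
    using coherent_le[OF that(4) q_in[OF that(1)] q_in[OF that(2)]] q_label[OF that(1-3)] by simp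
  show "\<forall>v\<in>VM. \<exists>v'\<in>VM. \<exists>e\<in>M. src B e = v \<and> rng B e = v'"
  proof
    fix v assume "v \<in> VM"
    then obtain n x where x: "x \<in> S" "v = vertex n (q x)" using VM by blast
    have "src B (edge (Suc n) (q x)) = v" "rng B (edge (Suc n) (q x)) = vertex (Suc n) (q x)"
      using x q_in by auto
    moreover have "vertex (Suc n) (q x) \<in> VM"
      unfolding VM_def verts_B using M_q[OF x(1), of "Suc n"] q_in[OF x(1)] by force
    ultimately show "\<exists>v'\<in>VM. \<exists>e\<in>M. src B e = v \<and> rng B e = v'" using M_q[OF x(1)] by blast
  qed
  show "\<forall>v\<in>VM. \<forall>e\<in>M. rng B e \<in> R_of B v \<longrightarrow> src B e = v"
  proof (intro ballI impI)
    fix v e assume "v \<in> VM" and e: "e \<in> M" "rng B e \<in> R_of B v"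
    then obtain n x where x: "x \<in> S" "v = vertex n (q x)" using VM by blast
    obtain k y where y: "e = edge (Suc k) y" "y \<in> S" using M_sub e(1) unfolding edges_B by blast
    obtain p where p: "p \<in> S" "vertex (Suc k) y = vertex (Suc n) p" "l n p = l n (q x)"
      using e(2) unfolding x(2) R_of_vertex y(1) rng_edge by blast
    then have k: "k = n" and l: "l (Suc n) y = l (Suc n) p" by auto
    have "l n y = l n (q y)" using M_label e(1) y k by blast
    also have "\<dots> = l n (q p)" using q_label_le[OF y(2) p(1) l, of n] by simp
    also have "\<dots> = l n (q x)" using q_label[OF p(1) q_in[OF x(1)] p(3)] q_q[OF x(1)] by simp
    finally show "src B e = v" using x y k by simp
  qed
  show "\<forall>v\<in>VM. \<forall>m>0. R_iter B m {v} = (R_iter B m \<circ> S_iter B m \<circ> R_iter B m) {v}"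
  proof (intro ballI allI impI)
    fix v and m :: nat assume "v \<in> VM" and m: "m > 0"
    then obtain n x where x: "x \<in> S" "v = vertex n (q x)" using VM by blast
    \<comment> \<open>Knowledge of the marked vertex at level \<open>n\<close> is constant along paths.\<close>
    have only: "\<exists>p\<in>S. u = vertex (n + k) p \<and> l n (q p) = l n (q a)"
      if "u \<in> R_iter B k {vertex n a}" "a \<in> S" for u k a
      using that(1)
    proof (induction k arbitrary: u)
      case 0
      then show ?case using that(2) by auto
    next
      case (Suc k)
      then obtain w where w: "w \<in> R_iter B k {vertex n a}" "u \<in> R_of B w" unfolding R_iter_Suc by blast
      obtain p where p: "p \<in> S" "w = vertex (n + k) p" "l n (q p) = l n (q a)" using Suc.IH[OF w(1)] by blast
      obtain p' where p': "p' \<in> S" "u = vertex (Suc (n + k)) p'" "l (n + k) p' = l (n + k) p"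
        using w(2) unfolding p(2) R_of_vertex by blast
      have "l n (q p') = l n (q p)" using q_label_le[OF p'(1) p(1) p'(3), of n] by simp
      then show ?case using p p' by auto
    qed
    \<comment> \<open>Conversely the marked vertex reaches every vertex that knows it.\<close>
    have all: "u \<in> R_iter B m {v}" if u: "p \<in> S" "u = vertex (n + m) p" "l n (q p) = l n (q x)" for p u
    proof -
      obtain y where y: "y \<in> S" "l (n + m) y = l (n + m) p" "l n y = l n (q p)"
        using q_visited[OF u(1), of n "n + m"] m by auto
      then have "vertex (n + m) y = u" "vertex n y = v" using u x by auto
      then show ?thesis using vertex_in_R_iter[OF y(1), of n m] by simp
    qed
    have "R_iter B m {w} \<subseteq> R_iter B m {v}" if w: "w \<in> S_iter B m (R_iter B m {v})" for w
    proof
      fix u' assume u': "u' \<in> R_iter B m {w}"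
      obtain u where u: "u \<in> R_iter B m {v}" "u \<in> R_iter B m {w}"
        using w by (subst (asm) S_iter_eq_UN) (auto simp: S_iter_iff_R_iter)
      obtain p where p: "p \<in> S" "u = vertex (n + m) p" "l n (q p) = l n (q (q x))"
        using only[OF u(1)[unfolded x(2)] q_in[OF x(1)]] by blast
      have "w \<in> S_iter B m {u}" using u(2) by (simp add: S_iter_iff_R_iter)
      moreover have "\<exists>a\<in>S. c = vertex (n + m - k) a" if "c \<in> S_iter B k {u}" "k \<le> m" for c k
        using that
      proof (induction k arbitrary: c)
        case 0
        then show ?case using p by auto
      next
        case (Suc k)
        then obtain d where d: "d \<in> S_iter B k {u}" "c \<in> S_of B d" unfolding S_iter_Suc by blast
        then obtain a where a: "a \<in> S" "d = vertex (n + m - k) a" using Suc by force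
        obtain e where "e \<in> edges B" "rng B e = d" "c = src B e" using d(2) unfolding S_of_def by blast
        then obtain j z where z: "e = edge (Suc j) z" "z \<in> S" "rng B e = d" "c = src B e" unfolding edges_B by blast
        then have "Suc j = n + m - k" using a by simp
        then have "j = n + m - Suc k" by simp
        then show ?case using z by auto
      qed
      ultimately obtain a where a: "a \<in> S" "w = vertex n a" by force
      obtain p2 where p2: "p2 \<in> S" "u = vertex (n + m) p2" "l n (q p2) = l n (q a)"
        using only[OF u(2)[unfolded a(2)] a(1)] by blast
      have "l n (q p) = l n (q p2)" using q_label_le[OF p(1) p2(1), of "n + m" n] p(2) p2(2) by simp
      then have "l n (q a) = l n (q x)" using p(3) p2(3) q_q[OF x(1)] by simp
      moreover obtain p3 where "p3 \<in> S" "u' = vertex (n + m) p3" "l n (q p3) = l n (q a)"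
        using only[OF u'[unfolded a(2)] a(1)] by blast
      ultimately show "u' \<in> R_iter B m {v}" using all by simp
    qed
    moreover have "v \<in> S_iter B m (R_iter B m {v})"
    proof -
      have "vertex (n + m) (q x) \<in> R_iter B m {v}" using vertex_in_R_iter[OF q_in[OF x(1)], of n m] x by simp
      then show ?thesis by (subst S_iter_eq_UN) (auto simp: S_iter_iff_R_iter)
    qed
    ultimately have "R_iter B m (S_iter B m (R_iter B m {v})) = R_iter B m {v}"
      by (subst R_iter_eq_UN) blast
    then show "R_iter B m {v} = (R_iter B m \<circ> S_iter B m \<circ> R_iter B m) {v}" by simp
  qed
qed

end

section \<open>Path space and Vershik successor in any ordered diagram\<close>

lemma openin_path_topology_cylinder: "k \<ge> 1 \<Longrightarrow> openin (path_topology B) (cylinder B k e)"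
  unfolding path_topology_def by (rule topology_generated_by_Basis) blast

lemma Hausdorff_path_topology: "Hausdorff_space (path_topology B)"
  unfolding Hausdorff_space_def topspace_path_topology
proof (intro allI impI, elim conjE)
  fix x y assume x: "x \<in> paths B" and y: "y \<in> paths B" and "x \<noteq> y"
  have "\<exists>n\<ge>1. x n \<noteq> y n"
  proof (rule ccontr)
    assume "\<not> (\<exists>n\<ge>1. x n \<noteq> y n)"
    then have "x = y" using x y unfolding paths_def by (intro PiE_ext[of x "{1..}" "Elevel B" y]) auto
    then show False using \<open>x \<noteq> y\<close> by simp
  qed
  then obtain n where n: "n \<ge> 1" "x n \<noteq> y n" by blast
  have "disjnt (cylinder B n x) (cylinder B n y)"
    unfolding disjnt_iff cylinder_def using n by force
  moreover have "x \<in> cylinder B n x" "y \<in> cylinder B n y" using x y unfolding cylinder_def by auto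
  ultimately show "\<exists>U V. openin (path_topology B) U \<and> openin (path_topology B) V \<and> x \<in> U \<and> y \<in> V \<and> disjnt U V"
    using openin_path_topology_cylinder[OF n(1)] by blast
qed

lemma Emin_eqI:
  assumes "ordered_bratteli_diagram B" "e \<in> Emin B" "f \<in> Emin B" "rng B e = rng B f"
  shows "e = f"
proof -
  have "e \<in> edges B" "f \<in> edges B" using assms(2,3) unfolding Emin_def by auto
  then have "(e, f) \<in> ord B \<or> (f, e) \<in> ord B"
    using assms(1,4) unfolding ordered_bratteli_diagram_def by blast
  then show ?thesis
    using assms(2,3) \<open>e \<in> edges B\<close> \<open>f \<in> edges B\<close> unfolding Emin_def by blast
qed

lemma is_successor_unique:
  assumes "ordered_bratteli_diagram B" "is_successor B e f" "is_successor B e f'"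
  shows "f = f'"
proof -
  have "(f, f') \<in> ord B" "(f', f) \<in> ord B"
    using assms(2,3) unfolding is_successor_def by auto
  moreover have "antisym (ord B)"
    using assms(1) unfolding ordered_bratteli_diagram_def partial_order_on_def by blast
  ultimately show ?thesis by (meson antisymD)
qed

text \<open>The three conditions in the definition of the successor path determine it: the successor edge is
  unique, and below it the minimal edge into a given vertex is unique, so one argues downwards from \<open>k\<close>.\<close>

lemma vershik_image_unique:
  assumes B: "ordered_bratteli_diagram B" and k: "k \<ge> 1"
    and y: "y \<in> paths B" "\<forall>j\<in>{1..<k}. y j \<in> Emin B" "is_successor B e (y k)" "\<forall>j>k. y j = x j"
    and y': "y' \<in> paths B" "\<forall>j\<in>{1..<k}. y' j \<in> Emin B" "is_successor B e (y' k)" "\<forall>j>k. y' j = x j"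
  shows "y = y'"
proof -
  have eq_k: "y k = y' k" using is_successor_unique[OF B] y(3) y'(3) by blast
  have below: "y j = y' j" if "1 \<le> j" "j \<le> k" for j
    using that(2,1)
  proof (induction rule: inc_induct)
    case base
    then show ?case using eq_k by simp
  next
    case (step j)
    have "rng B (y j) = src B (y (Suc j))" "rng B (y' j) = src B (y' (Suc j))"
      using y(1) y'(1) step.prems unfolding paths_def by auto
    moreover have "y (Suc j) = y' (Suc j)" using step by simp
    moreover have "y j \<in> Emin B" "y' j \<in> Emin B" using y(2) y'(2) step by auto
    ultimately show ?case using Emin_eqI[OF B] by simp
  qed
  have "y j = y' j" if "j \<in> {1..}" for j
    using below[of j] y(4) y'(4) that by (cases "j \<le> k") auto
  then show ?thesis using y(1) y'(1) unfolding paths_def by (intro PiE_ext[of y "{1..}" "Elevel B" y']) auto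
qed

section \<open>The path space of a fibred tower sequence\<close>

text \<open>A tower sequence adapted to the fibration \<open>\<psi>\<close>. The last three hypotheses are those behind (b), (c) and
  (d): points of \<open>Y (Suc n)\<close> lie in the same tower of level \<open>n\<close> as the marked point of their fibre, and
  likewise one step earlier in time, and the label of a tower determines the towers of \<open>\<psi> x\<close> and
  \<open>h\<inverse> (\<psi> x)\<close> for its points \<open>x\<close>.\<close>

locale fibred_tower_sequence = tower_sequence "topspace X" h g Y L
  for X :: "'a topology" and h g Y L +
  fixes \<psi> :: "'a \<Rightarrow> 'a" and Z :: "'a set"
  assumes compact: "compact_space X" and Hausdorff: "Hausdorff_space X"
    and homeo: "homeomorphic_maps X X h g"
    and lc_floor: "locally_constant X (floor_time g (Y n))"
    and lc_label: "locally_constant X (tower_label g (Y n) (L n))"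
    and separating: "\<lbrakk>x \<in> topspace X; y \<in> topspace X;
        \<And>n. floor_time g (Y n) x = floor_time g (Y n) y \<and>
             tower_label g (Y n) (L n) x = tower_label g (Y n) (L n) y\<rbrakk> \<Longrightarrow> x = y"
    and Z_eq: "Z = (\<Inter>n. Y n)"
    and \<psi>_cont: "continuous_map X X \<psi>"
    and \<psi>_in_Z: "x \<in> topspace X \<Longrightarrow> \<psi> x \<in> Z" and \<psi>_Z: "z \<in> Z \<Longrightarrow> \<psi> z = z"
    and \<psi>_h: "x \<in> topspace X \<Longrightarrow> \<psi> (h x) = \<psi> x"
    and marked_base: "y \<in> Y (Suc n) \<Longrightarrow>
          tower_label g (Y n) (L n) y = tower_label g (Y n) (L n) (\<psi> y)"
    and marked_top: "y \<in> Y (Suc n) \<Longrightarrow>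
          tower_label g (Y n) (L n) (g y) = tower_label g (Y n) (L n) (g (\<psi> y))"
    and fibre_label: "\<lbrakk>x \<in> topspace X; x' \<in> topspace X;
        tower_label g (Y n) (L n) x = tower_label g (Y n) (L n) x'\<rbrakk> \<Longrightarrow>
        tower_label g (Y n) (L n) (\<psi> x) = tower_label g (Y n) (L n) (\<psi> x') \<and>
        tower_label g (Y n) (L n) (g (\<psi> x)) = tower_label g (Y n) (L n) (g (\<psi> x'))"
begin

abbreviation "S \<equiv> topspace X"

lemma Z_sub: "Z \<subseteq> S"
  using Y_sub unfolding Z_eq by blast

lemma Z_Y: "z \<in> Z \<Longrightarrow> z \<in> Y n"
  unfolding Z_eq by blast

lemma \<psi>_in: "x \<in> S \<Longrightarrow> \<psi> x \<in> S"
  using \<psi>_in_Z Z_sub by blast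

lemma \<psi>_g: "x \<in> S \<Longrightarrow> \<psi> (g x) = \<psi> x"
  using \<psi>_h[of "g x"] g_in hg by simp

lemma \<psi>_hpow: "x \<in> S \<Longrightarrow> \<psi> ((h ^^ k) x) = \<psi> x"
  by (induction k) (auto simp: \<psi>_h hpow_in)

lemma \<psi>_gpow: "x \<in> S \<Longrightarrow> \<psi> ((g ^^ k) x) = \<psi> x"
  by (induction k) (auto simp: \<psi>_g gpow_in)

lemma Z_fibre: "x \<in> Z \<Longrightarrow> \<psi> x = z \<Longrightarrow> x = z"
  using \<psi>_Z by simp

text \<open>A fibre contains only one point of \<open>Z\<close>. In particular a point of \<open>Z\<close> with image in \<open>Z\<close> is fixed.\<close>

lemma h_in_Z: "x \<in> S \<Longrightarrow> h x \<in> Z \<Longrightarrow> h x = \<psi> x"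
  using \<psi>_Z[of "h x"] \<psi>_h by simp

definition path_of :: "'a \<Rightarrow> nat \<Rightarrow> nat" where
  "path_of x = restrict (\<lambda>n. edge n x) {1..}"

lemma path_of_apply [simp]: "path_of x (Suc n) = edge (Suc n) x"
  by (simp add: path_of_def)

lemma path_of_in_paths: "x \<in> S \<Longrightarrow> path_of x \<in> paths B"
  unfolding paths_def path_of_def
proof (intro CollectI conjI allI impI)
  fix n :: nat assume x: "x \<in> S" and "1 \<le> n"
  then obtain m where "n = Suc m" by (cases n) auto
  then show "rng B (restrict (\<lambda>n. edge n x) {1..} n) = src B (restrict (\<lambda>n. edge n x) {1..} (Suc n))"
    using x by simp
qed auto

text \<open>The floors are the partial sums of the offsets, so the path recovers labels and floors at every level.\<close>

lemma path_of_inj: "inj_on path_of S"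
proof (rule inj_onI)
  fix x y assume xy: "x \<in> S" "y \<in> S" "path_of x = path_of y"
  have ed: "edge (Suc n) x = edge (Suc n) y" for n using fun_cong[OF xy(3), of "Suc n"] unfolding path_of_apply .
  have "t n x = t n y" for n
  proof (induction n)
    case (Suc n)
    then show ?case using offset_t xy(1,2) ed[of n] by simp
  qed (simp add: t_0 xy)
  moreover have "l n x = l n y" for n
    using ed[of "n - 1"] by (cases n) (auto simp: l_0)
  ultimately show "x = y" using separating[OF xy(1,2)] unfolding t_def l_def by blast
qed

lemma locally_constant_t: "locally_constant X (t n)"
  unfolding t_def by (rule lc_floor)

lemma locally_constant_edge: "locally_constant X (edge n)"
proof -
  have "locally_constant X (offset (n - 1))"
    unfolding offset_def[abs_def]
    by (rule locally_constant_comp2[where \<phi> = "(-)", OF locally_constant_t locally_constant_t])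
  moreover have "locally_constant X (l n)" unfolding l_def by (rule lc_label)
  ultimately show ?thesis
    unfolding edge_def[abs_def]
    by (rule locally_constant_comp2[where \<phi> = "\<lambda>c k. prod_encode (n, prod_encode (c, k))", rotated])
qed

text \<open>By induction, extending a point \<open>q\<close> that realises the first edges: the next edge is realised by some point
  in the same tower of level \<open>N + 1\<close>, and moving that point, within its passage through this tower, to the
  floor of \<open>q\<close> keeps the next edge and, by coherence, restores all the earlier ones.\<close>

lemma finite_path_realised:
  assumes p: "p \<in> paths B"
  shows "\<exists>q\<in>S. \<forall>j\<le>N. edge (Suc j) q = p (Suc j)"
proof -
  have "p (Suc n) \<in> edge (Suc n) ` S" for n using p unfolding paths_def by (auto simp: PiE_iff)
  then have "\<exists>w. w \<in> S \<and> p (Suc n) = edge (Suc n) w" for n by blast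
  then obtain w where w: "\<And>n. w n \<in> S" "\<And>n. p (Suc n) = edge (Suc n) (w n)" by metis
  have link: "l (Suc n) (w n) = l (Suc n) (w (Suc n))" for n
  proof -
    have "rng B (p (Suc n)) = src B (p (Suc (Suc n)))" using p unfolding paths_def by simp
    then show ?thesis using w by simp
  qed
  show ?thesis
  proof (induction N)
    case 0
    then show ?case using w by (metis le_zero_eq)
  next
    case (Suc N)
    then obtain q where q: "q \<in> S" "\<And>j. j \<le> N \<Longrightarrow> edge (Suc j) q = p (Suc j)" by blast
    let ?w = "w (Suc N)" and ?k = "t (Suc N) q"
    have lq: "l (Suc N) q = l (Suc N) ?w" using q(2)[of N] w(2)[of N] link[of N] by simp
    have k: "?k \<le> t (Suc N) ?w + r (Suc N) ?w"
      using height_eq[OF q(1) w(1) lq] by linarith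
    let ?q = "(h ^^ ?k) (b (Suc N) ?w)"
    note st = same_tower[OF w(1) k] and sS = same_tower_Suc[OF w(1) k]
    have "edge (Suc j) ?q = p (Suc j)" if j: "j \<le> Suc N" for j
    proof (cases "j = Suc N")
      case True
      then show ?thesis using sS w(2)[of "Suc N"] by simp
    next
      case False
      then have "j \<le> N" using j by simp
      have "t i ?q = t i q \<and> l i ?q = l i q" if "i \<le> Suc N" for i
        using coherent_le[OF that st(1) q(1)] st(2,4) lq by simp
      from this[of j] this[of "Suc j"] have "edge (Suc j) ?q = edge (Suc j) q"
        using \<open>j \<le> N\<close> by (simp add: offset_def)
      then show ?thesis using q(2) \<open>j \<le> N\<close> by simp
    qed
    then show ?case using st(1) by blast
  qed
qed

lemma path_of_surj: "path_of ` S = paths B"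
proof
  show "path_of ` S \<subseteq> paths B" using path_of_in_paths by blast
  show "paths B \<subseteq> path_of ` S"
  proof
    fix p assume p: "p \<in> paths B"
    define C where "C N = {q \<in> S. map (\<lambda>j. edge (Suc j) q) [0..<Suc N] \<in> {map (\<lambda>j. p (Suc j)) [0..<Suc N]}}" for N
    have C_iff: "q \<in> C N \<longleftrightarrow> q \<in> S \<and> (\<forall>j\<le>N. edge (Suc j) q = p (Suc j))" for q N
      unfolding C_def by (auto simp del: upt_Suc simp: less_Suc_eq_le)
    have "(\<Inter>N. C N) \<noteq> {}"
    proof (rule compact_space_imp_nest[OF compact])
      show "closedin X (C N)" for N unfolding C_def
        by (intro closedin_locally_constant_Collect locally_constant_map_list locally_constant_edge)
      show "C N \<noteq> {}" for N using finite_path_realised[OF p, of N] C_iff by blast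
      show "decseq C" unfolding decseq_def using C_iff by auto
    qed
    then obtain q where q: "\<And>N. q \<in> C N" by blast
    have "path_of q j = p j" if j: "j \<in> {1..}" for j
    proof -
      obtain m where "j = Suc m" using j by (cases j) auto
      then show ?thesis using q[of m] C_iff by simp
    qed
    moreover have "q \<in> S" using q C_iff by blast
    ultimately have "path_of q = p"
      using p path_of_in_paths unfolding paths_def by (intro PiE_ext[of _ "{1..}" "Elevel B"]) auto
    then show "p \<in> path_of ` S" using \<open>q \<in> S\<close> by blast
  qed
qed

lemma continuous_path_of: "continuous_map X (path_topology B) path_of"
  unfolding path_topology_def
proof (rule continuous_on_generated_topo)
  show "path_of ` S \<subseteq> \<Union> {cylinder B k e |k e. 1 \<le> k}"
    using topspace_path_topology[of B] path_of_in_paths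
    unfolding path_topology_def topology_generated_by_topspace by blast
  fix U assume "U \<in> {cylinder B k e |k e. 1 \<le> k}"
  then obtain k e where U: "U = cylinder B k e" by blast
  have "path_of -` U \<inter> S = {x \<in> S. map (\<lambda>j. edge (Suc j) x) [0..<k] \<in> {map (\<lambda>j. e (Suc j)) [0..<k]}}"
  proof (rule set_eqI)
    fix x
    have "(\<forall>j\<in>{1..k}. path_of x j = e j) \<longleftrightarrow> (\<forall>i<k. edge (Suc i) x = e (Suc i))"
    proof
      assume L: "\<forall>j\<in>{1..k}. path_of x j = e j"
      show "\<forall>i<k. edge (Suc i) x = e (Suc i)"
      proof (intro allI impI)
        fix i assume "i < k"
        then show "edge (Suc i) x = e (Suc i)" using bspec[OF L, of "Suc i"] by simp
      qed
    next
      assume R: "\<forall>i<k. edge (Suc i) x = e (Suc i)"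
      show "\<forall>j\<in>{1..k}. path_of x j = e j"
      proof
        fix j assume "j \<in> {1..k}"
        then show "path_of x j = e j" using R by (cases j) auto
      qed
    qed
    then show "x \<in> path_of -` U \<inter> S \<longleftrightarrow>
        x \<in> {x \<in> S. map (\<lambda>j. edge (Suc j) x) [0..<k] \<in> {map (\<lambda>j. e (Suc j)) [0..<k]}}"
      unfolding U cylinder_def using path_of_in_paths by auto
  qed
  then show "openin X (path_of -` U \<inter> S)"
    by (simp only:) (intro openin_locally_constant_Collect locally_constant_map_list locally_constant_edge)
qed

lemma homeomorphic_path_of: "homeomorphic_map X (path_topology B) path_of"
  by (rule continuous_imp_homeomorphic_map[OF continuous_path_of compact Hausdorff_path_topology])
     (use path_of_surj path_of_inj in auto)

lemma path_of_in_paths_min_iff: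
  assumes x: "x \<in> S"
  shows "path_of x \<in> paths_min B \<longleftrightarrow> x \<in> Z"
proof
  assume "path_of x \<in> paths_min B"
  then have "edge (Suc n) x \<in> Emin B" for n unfolding paths_min_def using path_of_apply
    by (metis (lifting) One_nat_def Suc_le_mono le0 mem_Collect_eq)
  then have off: "offset n x = 0" for n using edge_in_Emin_iff[OF x] by blast
  have "t n x = 0" for n by (induction n) (auto simp: t_0[OF x] offset_t[OF x] off)
  then show "x \<in> Z" unfolding Z_eq using t_eq_0_iff[OF x] by blast
next
  assume z: "x \<in> Z"
  have "t n x = 0" for n using t_eq_0_iff[OF x] Z_Y[OF z] by blast
  then have e: "edge (Suc n) x \<in> Emin B" for n unfolding edge_in_Emin_iff[OF x] offset_def by simp
  have "path_of x j \<in> Emin B" if "j \<ge> 1" for j using e[of "j - 1"] that by (cases j) auto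
  then show "path_of x \<in> paths_min B" unfolding paths_min_def using path_of_in_paths[OF x] by blast
qed

text \<open>All edges are maximal iff the remaining times agree at all levels, and at level \<open>0\<close> it is zero.\<close>

lemma path_of_in_paths_max_iff:
  assumes x: "x \<in> S"
  shows "path_of x \<in> paths_max B \<longleftrightarrow> h x \<in> Z"
proof
  assume "path_of x \<in> paths_max B"
  then have "edge (Suc n) x \<in> Emax B" for n unfolding paths_max_def using path_of_apply
    by (metis (lifting) One_nat_def Suc_le_mono le0 mem_Collect_eq)
  then have off: "r n x = r (Suc n) x" for n using edge_in_Emax_iff[OF x] by blast
  have "r n x = 0" for n by (induction n) (auto simp: r_0[OF x] off[symmetric])
  then show "h x \<in> Z" unfolding Z_eq using r_eq_0_iff[OF x] by blast
next
  assume z: "h x \<in> Z"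
  have "r n x = 0" for n using r_eq_0_iff[OF x] Z_Y[OF z] by blast
  then have e: "edge (Suc n) x \<in> Emax B" for n unfolding edge_in_Emax_iff[OF x] by simp
  have "path_of x j \<in> Emax B" if "j \<ge> 1" for j using e[of "j - 1"] that by (cases j) auto
  then show "path_of x \<in> paths_max B" unfolding paths_max_def using path_of_in_paths[OF x] by blast
qed

lemma paths_min_B: "paths_min B = path_of ` Z"
proof -
  have "paths_min B \<subseteq> path_of ` S" unfolding path_of_surj paths_min_def by blast
  then show ?thesis using path_of_in_paths_min_iff Z_sub by blast
qed

lemma path_of_in_vershik_dom_iff:
  "x \<in> S \<Longrightarrow> path_of x \<in> vershik_dom B \<longleftrightarrow> h x \<notin> Z \<or> x \<in> Z"
  unfolding vershik_dom_def using path_of_in_paths_min_iff path_of_in_paths_max_iff path_of_in_paths by blast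

text \<open>The lowest non-maximal edge sits at the first level \<open>m\<close> whose base is not entered by \<open>h x\<close>. Below \<open>m\<close> the
  point \<open>h x\<close> is in the base, so its edges are minimal; at level \<open>m\<close> a new passage starts, which is the next
  edge; above \<open>m\<close> the passages of \<open>x\<close> continue.\<close>

lemma partial_vershik_path_of:
  assumes x: "x \<in> S" and dom: "h x \<notin> Z \<or> x \<in> Z"
  shows "partial_vershik B (path_of x) = path_of (h x)"
proof (cases "h x \<in> Z")
  case True
  then have "x \<in> Z" using dom by blast
  then have "h x = x" using h_in_Z[OF x True] \<psi>_Z by simp
  then show ?thesis
    using True \<open>x \<in> Z\<close> path_of_in_paths_min_iff[OF x] path_of_in_paths_max_iff[OF x]
    unfolding partial_vershik_def by simp
next
  case False
  then obtain n0 where n0: "r n0 x > 0" unfolding Z_eq using r_eq_0_iff[OF x] by blast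
  define m where "m = (LEAST n. r n x > 0)"
  have rm: "r m x > 0" unfolding m_def using n0 by (rule LeastI)
  have below: "r n x = 0" if "n < m" for n using not_less_Least[of n "\<lambda>n. r n x > 0"] that m_def by auto
  obtain m' where m': "m = Suc m'" using rm r_0[OF x] by (cases m) auto
  have k: "(LEAST k. k \<ge> 1 \<and> path_of x k \<notin> Emax B) = Suc m'"
  proof (rule Least_equality)
    show "1 \<le> Suc m' \<and> path_of x (Suc m') \<notin> Emax B"
      using edge_in_Emax_iff[OF x, of m'] below[of m'] rm m' by simp
    fix k assume k: "1 \<le> k \<and> path_of x k \<notin> Emax B"
    then obtain k' where k': "k = Suc k'" by (cases k) auto
    show "Suc m' \<le> k"
    proof (rule ccontr)
      assume "\<not> Suc m' \<le> k"
      then have "r k' x = r (Suc k') x" using below k' m' by simp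
      then show False using k k' edge_in_Emax_iff[OF x, of k'] by simp
    qed
  qed
  have hx: "h x \<in> S" using h_in[OF x] .
  have t0: "t n (h x) = 0" if "n < m" for n
    using t_eq_0_iff[OF hx] r_eq_0_iff[OF x] below[OF that] by simp
  have step: "t n (h x) = Suc (t n x)" "l n (h x) = l n x" if "m \<le> n" for n
    using step_inside[OF x, of n] r_mono[OF x that] rm by auto
  let ?P = "\<lambda>y. y \<in> paths B \<and> (\<forall>j\<in>{1..<Suc m'}. y j \<in> Emin B) \<and>
                is_successor B (path_of x (Suc m')) (y (Suc m')) \<and> (\<forall>j>Suc m'. y j = path_of x j)"
  have P: "?P (path_of (h x))"
  proof (intro conjI ballI allI impI)
    show "path_of (h x) \<in> paths B" using path_of_in_paths[OF hx] .
    show "is_successor B (path_of x (Suc m')) (path_of (h x) (Suc m'))"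
      using is_successor_next_visit[OF x, of m'] below[of m'] rm m' by simp
    fix j
    { assume "j \<in> {1..<Suc m'}"
      then obtain i where i: "j = Suc i" "Suc i < m" using m' by (cases j) auto
      then show "path_of (h x) j \<in> Emin B" using edge_in_Emin_iff[OF hx, of i] t0 by (simp add: offset_def) }
    { assume "Suc m' < j"
      then obtain i where i: "j = Suc i" "m \<le> i" using m' by (cases j) auto
      then show "path_of (h x) j = path_of x j" using step[of i] step[of "Suc i"] by (simp add: offset_def) }
  qed
  have "(THE y. ?P y) = path_of (h x)"
  proof (rule the_equality[of ?P, OF P])
    fix y assume "?P y"
    then show "y = path_of (h x)"
      using P by (intro vershik_image_unique[OF ordered_bratteli_diagram_B, of "Suc m'" y _ "path_of x"]) auto
  qed
  moreover have "path_of x \<notin> paths_max B" using False path_of_in_paths_max_iff[OF x] by blast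
  ultimately show ?thesis unfolding partial_vershik_def k by (simp add: Let_def)
qed

end

section \<open>Vershik orbits and perfectness\<close>

context fibred_tower_sequence
begin

lemma vershik_graph_B:
  "vershik_graph B = {(path_of x, path_of (h x)) |x. x \<in> S \<and> (h x \<notin> Z \<or> x \<in> Z)}"
proof -
  have "p \<in> path_of ` S" if "p \<in> vershik_dom B" for p
    using that unfolding path_of_surj vershik_dom_def paths_min_def by blast
  then have "vershik_graph B = {(path_of x, partial_vershik B (path_of x)) |x. x \<in> S \<and> path_of x \<in> vershik_dom B}"
    unfolding vershik_graph_def by blast
  then show ?thesis using partial_vershik_path_of path_of_in_vershik_dom_iff by auto
qed

lemma vershik_orbit_in_fibre:
  assumes x: "x \<in> S"
  shows "vershik_orbit B (path_of x) \<subseteq> path_of ` {y \<in> S. \<psi> y = \<psi> x}" (is "_ \<subseteq> ?F")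
proof -
  have fwd: "q \<in> ?F" if pq: "p \<in> ?F" "(p, q) \<in> vershik_graph B" for p q
    using pq unfolding vershik_graph_B using path_of_inj h_in \<psi>_h by (auto simp: inj_on_eq_iff)
  have bwd: "q \<in> ?F" if pq: "p \<in> ?F" "(q, p) \<in> vershik_graph B" for p q
    using pq unfolding vershik_graph_B using path_of_inj h_in \<psi>_h by (auto simp: inj_on_eq_iff)
  have start: "path_of x \<in> ?F" using x by blast
  have "q \<in> ?F" if "(path_of x, q) \<in> (vershik_graph B)\<^sup>*" for q
    using that by (induction rule: rtrancl_induct) (use start fwd in blast)+
  moreover have "q \<in> ?F" if "(path_of x, q) \<in> ((vershik_graph B)\<inverse>)\<^sup>*" for q
    using that
  proof (induction rule: rtrancl_induct)
    case base
    then show ?case using start .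
  next
    case (step p q)
    then show ?case using bwd[of p q] by simp
  qed
  ultimately show ?thesis unfolding vershik_orbit_def by blast
qed

lemma closedin_fibre: "closedin X {y \<in> S. \<psi> y = z}"
proof (cases "z \<in> S")
  case True
  then have "closedin X {z}" by (metis Hausdorff Hausdorff_imp_t1_space t1_space_closedin_singleton)
  then show ?thesis using closedin_continuous_map_preimage[OF \<psi>_cont, of "{z}"] by simp
next
  case False
  then have empty: "{y \<in> S. \<psi> y = z} = {}" using \<psi>_in by auto
  show ?thesis unfolding empty by (rule closedin_empty)
qed

text \<open>The homeomorphism transports the closure to \<open>X\<close>.\<close>

lemma orbit_closure_path_of:
  assumes A: "A \<subseteq> S" "vershik_orbit B (path_of x) = path_of ` A"
  shows "orbit_closure B (path_of x) = path_of ` (X closure_of A)"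
  unfolding orbit_closure_def A(2)
  by (rule homeomorphic_map_closure_of[OF homeomorphic_path_of A(1)])

lemma orbit_closure_in_fibre:
  assumes x: "x \<in> S"
  shows "orbit_closure B (path_of x) \<subseteq> path_of ` {y \<in> S. \<psi> y = \<psi> x}" (is "_ \<subseteq> path_of ` ?F")
proof -
  obtain A where A: "A \<subseteq> ?F" "vershik_orbit B (path_of x) = path_of ` A"
    using vershik_orbit_in_fibre[OF x] by (meson subset_imageE)
  then have "orbit_closure B (path_of x) = path_of ` (X closure_of A)"
    by (intro orbit_closure_path_of) auto
  moreover have "X closure_of A \<subseteq> ?F" using closure_of_minimal[OF A(1) closedin_fibre] .
  ultimately show ?thesis by blast
qed

lemma in_orbit_closureI:
  assumes x: "x \<in> S" and y: "y \<in> S"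
    and U: "\<And>U. \<lbrakk>openin X U; y \<in> U\<rbrakk> \<Longrightarrow> \<exists>w\<in>U. path_of w \<in> vershik_orbit B (path_of x)"
  shows "path_of y \<in> orbit_closure B (path_of x)"
proof -
  let ?A = "{w \<in> S. path_of w \<in> vershik_orbit B (path_of x)}"
  have "vershik_orbit B (path_of x) = path_of ` ?A"
    using vershik_orbit_in_fibre[OF x] by blast
  then have "orbit_closure B (path_of x) = path_of ` (X closure_of ?A)"
    by (intro orbit_closure_path_of) auto
  moreover have "y \<in> X closure_of ?A"
    unfolding in_closure_of using y U openin_subset by fastforce
  ultimately show ?thesis by blast
qed

text \<open>In the fibre over \<open>z\<close> the sets \<open>Y n\<close> decrease to \<open>{z}\<close>, so by compactness they form a neighbourhood base.\<close>

lemma base_shrinks_to_marked_point: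
  assumes z: "z \<in> Z" and U: "openin X U" "z \<in> U"
  shows "\<exists>n. \<forall>x\<in>Y n. \<psi> x = z \<longrightarrow> x \<in> U"
proof (rule ccontr)
  assume neg: "\<nexists>n. \<forall>x\<in>Y n. \<psi> x = z \<longrightarrow> x \<in> U"
  define C where "C n = Y n \<inter> {y \<in> S. \<psi> y = z} \<inter> (S - U)" for n
  have "(\<Inter>n. C n) \<noteq> {}"
  proof (rule compact_space_imp_nest[OF compact])
    fix n
    have "Y n = {x \<in> S. t n x \<in> {0}}" using t_eq_0_iff Y_sub by blast
    then have "closedin X (Y n)" using closedin_locally_constant_Collect[OF locally_constant_t] by metis
    then show "closedin X (C n)" unfolding C_def using U(1) closedin_fibre by blast
    show "C n \<noteq> {}" using neg Y_sub unfolding C_def by blast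
  next
    show "decseq C" unfolding decseq_def C_def using Y_antimono by blast
  qed
  then obtain x where "\<And>n. x \<in> C n" by blast
  then have "x \<in> Z" "\<psi> x = z" "x \<notin> U" unfolding C_def Z_eq by blast+
  then show False using Z_fibre U(2) by metis
qed

text \<open>The partial map can be iterated along the orbit of \<open>z\<close> until a maximal path occurs, and the only
  maximal path in this fibre is that of \<open>g z\<close>.\<close>

lemma forward_vershik_orbit:
  assumes z: "z \<in> Z"
  shows "path_of (g z) \<in> vershik_orbit B (path_of z) \<or> path_of ((h ^^ k) z) \<in> vershik_orbit B (path_of z)"
proof -
  have zS: "z \<in> S" using z Z_sub by blast
  have "(path_of z, path_of (g z)) \<in> (vershik_graph B)\<^sup>* \<or> (path_of z, path_of ((h ^^ k) z)) \<in> (vershik_graph B)\<^sup>*"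
  proof (induction k)
    case (Suc k)
    let ?y = "(h ^^ k) z"
    have y: "?y \<in> S" using hpow_in[OF zS] .
    show ?case
    proof (cases "h ?y \<in> Z")
      case True
      then have "h ?y = z" using h_in_Z[OF y] \<psi>_hpow[OF zS] \<psi>_Z[OF z] by simp
      then have "?y = g z" using gh[OF y] by simp
      then show ?thesis using Suc by simp
    next
      case False
      then have "(path_of ?y, path_of (h ?y)) \<in> vershik_graph B" unfolding vershik_graph_B using y by blast
      then show ?thesis using Suc by (auto intro: rtrancl_into_rtrancl)
    qed
  qed simp
  then show ?thesis unfolding vershik_orbit_def by blast
qed

lemma backward_vershik_orbit:
  assumes z: "z \<in> Z"
  shows "path_of z \<in> vershik_orbit B (path_of (g z)) \<or> path_of ((g ^^ k) (g z)) \<in> vershik_orbit B (path_of (g z))"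
proof -
  have zS: "z \<in> S" using z Z_sub by blast
  have gz: "g z \<in> S" using g_in[OF zS] .
  let ?G = "((vershik_graph B)\<inverse>)\<^sup>*"
  have "(path_of (g z), path_of z) \<in> ?G \<or> (path_of (g z), path_of ((g ^^ k) (g z))) \<in> ?G"
  proof (induction k)
    case (Suc k)
    let ?y = "(g ^^ k) (g z)"
    have y: "?y \<in> S" using gpow_in[OF gz] .
    have hy: "h (g ?y) = ?y" using hg[OF y] .
    show ?case
    proof (cases "?y \<in> Z")
      case True
      then have "?y = z" using \<psi>_Z[OF True] \<psi>_gpow[OF gz] \<psi>_g[OF zS] \<psi>_Z[OF z] by metis
      then show ?thesis using Suc by simp
    next
      case False
      then have "(path_of (g ?y), path_of (h (g ?y))) \<in> vershik_graph B"
        unfolding vershik_graph_B using g_in[OF y] hy by auto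
      then have "(path_of ?y, path_of (g ?y)) \<in> (vershik_graph B)\<inverse>" unfolding hy by blast
      then show ?thesis using Suc by (auto intro: rtrancl_into_rtrancl)
    qed
  qed simp
  then show ?thesis unfolding vershik_orbit_def by blast
qed

text \<open>The first return of \<open>z\<close> to \<open>Y n\<close> tends to \<open>z\<close> as \<open>n\<close> grows, so the points one step earlier tend to \<open>g z\<close>.\<close>

lemma max_path_in_orbit_closure:
  assumes z: "z \<in> Z"
  shows "path_of (g z) \<in> orbit_closure B (path_of z)"
proof -
  have zS: "z \<in> S" using z Z_sub by blast
  have gz: "g z \<in> S" using g_in[OF zS] .
  show ?thesis
  proof (rule in_orbit_closureI[OF zS gz])
    fix U assume U: "openin X U" "g z \<in> U"
    let ?V = "{x \<in> S. g x \<in> U}"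
    have "continuous_map X X g" using homeo unfolding homeomorphic_maps_def by blast
    then have "openin X ?V" using U(1) by (simp add: continuous_map_def)
    moreover have "z \<in> ?V" using U(2) zS by simp
    ultimately have "\<exists>n. \<forall>x\<in>Y n. \<psi> x = z \<longrightarrow> x \<in> ?V" by (rule base_shrinks_to_marked_point[OF z])
    then obtain n where n: "\<And>x. x \<in> Y n \<Longrightarrow> \<psi> x = z \<Longrightarrow> g x \<in> U" by blast
    let ?y = "(h ^^ r n z) z"
    have y: "?y \<in> S" using hpow_in[OF zS] .
    have "h ?y \<in> Y n" using top_returns[OF recurrent_Y[of n] zS] unfolding r_def by simp
    moreover have "\<psi> (h ?y) = z" using \<psi>_h[OF y] \<psi>_hpow[OF zS] \<psi>_Z[OF z] by simp
    ultimately have "?y \<in> U" using n[of "h ?y"] gh[OF y] by simp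
    then show "\<exists>w\<in>U. path_of w \<in> vershik_orbit B (path_of z)"
      using forward_vershik_orbit[OF z, of "r n z"] U(2) by blast
  qed
qed

lemma min_path_in_orbit_closure:
  assumes z: "z \<in> Z"
  shows "path_of z \<in> orbit_closure B (path_of (g z))"
proof -
  have zS: "z \<in> S" using z Z_sub by blast
  have gz: "g z \<in> S" using g_in[OF zS] .
  show ?thesis
  proof (rule in_orbit_closureI[OF gz zS])
    fix U assume U: "openin X U" "z \<in> U"
    then obtain n where n: "\<And>x. x \<in> Y n \<Longrightarrow> \<psi> x = z \<Longrightarrow> x \<in> U"
      using base_shrinks_to_marked_point[OF z U] by blast
    let ?y = "(g ^^ t n (g z)) (g z)"
    have "?y \<in> Y n" using b_in_Y[OF gz, of n] unfolding b_def base_point_def t_def .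
    moreover have "\<psi> ?y = z" using \<psi>_gpow[OF gz] \<psi>_g[OF zS] \<psi>_Z[OF z] by simp
    ultimately have "?y \<in> U" using n by simp
    then show "\<exists>w\<in>U. path_of w \<in> vershik_orbit B (path_of (g z))"
      using backward_vershik_orbit[OF z, of "t n (g z)"] U(2) by blast
  qed
qed

lemma orbit_closure_max:
  assumes z: "z \<in> Z"
  shows "orbit_closure B (path_of z) \<inter> paths_max B = {path_of (g z)}"
proof
  have zS: "z \<in> S" using z Z_sub by blast
  have gz: "g z \<in> S" "h (g z) = z" using g_in[OF zS] hg[OF zS] by auto
  show "{path_of (g z)} \<subseteq> orbit_closure B (path_of z) \<inter> paths_max B"
    using max_path_in_orbit_closure[OF z] path_of_in_paths_max_iff[OF gz(1)] gz(2) z by simp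
  show "orbit_closure B (path_of z) \<inter> paths_max B \<subseteq> {path_of (g z)}"
  proof
    fix p assume p: "p \<in> orbit_closure B (path_of z) \<inter> paths_max B"
    then obtain y where y: "y \<in> S" "\<psi> y = \<psi> z" "p = path_of y" using orbit_closure_in_fibre[OF zS] by blast
    then have "h y \<in> Z" using p path_of_in_paths_max_iff by blast
    then have "h y = z" using h_in_Z[OF y(1)] y(2) \<psi>_Z[OF z] by simp
    then show "p \<in> {path_of (g z)}" using gh[OF y(1)] y(3) by simp
  qed
qed

lemma orbit_closure_min:
  assumes z: "z \<in> Z"
  shows "orbit_closure B (path_of (g z)) \<inter> paths_min B = {path_of z}"
proof
  have zS: "z \<in> S" using z Z_sub by blast
  have gz: "g z \<in> S" using g_in[OF zS] .
  show "{path_of z} \<subseteq> orbit_closure B (path_of (g z)) \<inter> paths_min B"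
    using min_path_in_orbit_closure[OF z] path_of_in_paths_min_iff[OF zS] z by simp
  show "orbit_closure B (path_of (g z)) \<inter> paths_min B \<subseteq> {path_of z}"
  proof
    fix p assume p: "p \<in> orbit_closure B (path_of (g z)) \<inter> paths_min B"
    then obtain y where y: "y \<in> S" "\<psi> y = \<psi> (g z)" "p = path_of y" using orbit_closure_in_fibre[OF gz] by blast
    then have "y \<in> Z" using p path_of_in_paths_min_iff by blast
    then have "y = z" using y(2) \<psi>_Z \<psi>_g[OF zS] z by metis
    then show "p \<in> {path_of z}" using y(3) by simp
  qed
qed

lemma paths_max_B: "paths_max B = (\<lambda>z. path_of (g z)) ` Z"
proof
  show "paths_max B \<subseteq> (\<lambda>z. path_of (g z)) ` Z"
  proof
    fix p assume p: "p \<in> paths_max B"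
    then have "p \<in> path_of ` S" unfolding path_of_surj paths_max_def by blast
    then obtain x where x: "x \<in> S" "p = path_of x" by blast
    then have "h x \<in> Z" "p = path_of (g (h x))" using p path_of_in_paths_max_iff gh by auto
    then show "p \<in> (\<lambda>z. path_of (g z)) ` Z" by blast
  qed
  show "(\<lambda>z. path_of (g z)) ` Z \<subseteq> paths_max B"
  proof (rule image_subsetI)
    fix z assume z: "z \<in> Z"
    then have "z \<in> S" using Z_sub by blast
    then show "path_of (g z) \<in> paths_max B" using path_of_in_paths_max_iff[OF g_in] hg z by simp
  qed
qed

lemma perfect_ordering_B: "perfect_ordering B"
  unfolding perfect_ordering_def
proof (intro conjI ballI)
  fix e assume "e \<in> paths_min B"
  then obtain z where "z \<in> Z" "e = path_of z" unfolding paths_min_B by blast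
  then show "\<exists>!x. x \<in> orbit_closure B e \<inter> paths_max B" using orbit_closure_max by simp
next
  fix e assume "e \<in> paths_max B"
  then obtain z where "z \<in> Z" "e = path_of (g z)" unfolding paths_max_B by blast
  then show "\<exists>!x. x \<in> orbit_closure B e \<inter> paths_min B" using orbit_closure_min by simp
qed

text \<open>The Vershik transformation is the transport of \<open>h\<close>: the limit condition on \<open>paths_max B\<close> holds since
  the maximal path in the orbit closure of the path of \<open>z\<close> is that of \<open>h\<inverse> z\<close>.\<close>

lemma vershik_system_conjugate:
  "\<exists>h\<^sub>B. vershik_transformation B h\<^sub>B \<and> conjugate_triples (path_topology B) h\<^sub>B (paths_min B) X h Z"
proof -
  obtain F where F: "homeomorphic_maps X (path_topology B) path_of F"
    using homeomorphic_path_of homeomorphic_map_maps by blast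
  have F_path: "F (path_of x) = x" if "x \<in> S" for x
    using F that unfolding homeomorphic_maps_def by blast
  define k where "k = (\<lambda>p. path_of (h (F p)))"
  have k: "k (path_of x) = path_of (h x)" if "x \<in> S" for x
    unfolding k_def using F_path that by simp
  have pathE: "\<exists>x\<in>S. p = path_of x" if "p \<in> paths B" for p
    using that path_of_surj by blast
  have "vershik_transformation B k"
    unfolding vershik_transformation_def
  proof (intro conjI ballI)
    show "k \<in> paths B \<rightarrow> paths B"
    proof
      fix p assume "p \<in> paths B"
      then obtain x where "x \<in> S" "p = path_of x" using pathE by blast
      then show "k p \<in> paths B" using k path_of_in_paths h_in by simp
    qed
    fix p assume p: "p \<in> vershik_dom B"
    then obtain x where x: "x \<in> S" "p = path_of x"
      using pathE unfolding vershik_dom_def paths_min_def by blast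
    then show "k p = partial_vershik B p"
      using k partial_vershik_path_of[OF x(1)] path_of_in_vershik_dom_iff[OF x(1)] p by simp
  next
    fix e p assume "e \<in> paths_min B" and p: "p \<in> orbit_closure B e \<inter> paths_max B"
    then obtain z where z: "z \<in> Z" "e = path_of z" unfolding paths_min_B by blast
    then have "p = path_of (g z)" using p orbit_closure_max by blast
    then show "k p = e" using k g_in hg z Z_sub by auto
  qed
  moreover have "conjugate_triples (path_topology B) k (paths_min B) X h Z"
    unfolding conjugate_triples_def
  proof (intro exI conjI ballI)
    show "homeomorphic_map (path_topology B) X F"
      using F homeomorphic_maps_sym homeomorphic_maps_map by blast
    show "F (k p) = h (F p)" if "p \<in> topspace (path_topology B)" for p
      using pathE[of p] that k F_path h_in by auto
    show "F ` paths_min B = Z"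
      unfolding paths_min_B image_image using F_path Z_sub by (force simp: subset_iff)
  qed
  ultimately show ?thesis by blast
qed

end

section \<open>Extremal edges lie on the marked paths\<close>

context fibred_tower_sequence
begin

lemma Emin_sub: "Emin B \<subseteq> edges B" and Emax_sub: "Emax B \<subseteq> edges B"
  unfolding Emin_def Emax_def by blast+

lemma label_marked_base: "y \<in> Y (Suc n) \<Longrightarrow> l n y = l n (\<psi> y)"
  unfolding l_def by (rule marked_base)

lemma label_marked_top: "y \<in> Y (Suc n) \<Longrightarrow> l n (g y) = l n (g (\<psi> y))"
  unfolding l_def by (rule marked_top)

lemma label_fibre:
  "\<lbrakk>x \<in> S; x' \<in> S; l n x = l n x'\<rbrakk> \<Longrightarrow> l n (\<psi> x) = l n (\<psi> x')"
  "\<lbrakk>x \<in> S; x' \<in> S; l n x = l n x'\<rbrakk> \<Longrightarrow> l n (g (\<psi> x)) = l n (g (\<psi> x'))"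
  unfolding l_def using fibre_label by blast+

lemma \<psi>_b: "x \<in> S \<Longrightarrow> \<psi> (b n x) = \<psi> x"
  unfolding b_def base_point_def by (rule \<psi>_gpow)

text \<open>A point whose current edge is minimal has the same label at level \<open>n\<close> as its base point in \<open>Y (Suc n)\<close>.\<close>

lemma label_of_min_edge:
  assumes x: "x \<in> S" and e: "edge (Suc n) x \<in> Emin B"
  shows "l n x = l n (\<psi> x)"
proof -
  let ?y = "b (Suc n) x"
  have y: "?y \<in> Y (Suc n)" "?y \<in> S" using b_in_Y[OF x] b_in[OF x] by auto
  have "offset n ?y = 0" unfolding offset_def using base_Suc(3)[OF x, of "Suc n"] by simp
  then have "l n x = l n ?y"
    using offset_label[OF x y(2)] base_Suc(4)[OF x, of "Suc n"] e edge_in_Emin_iff[OF x] by simp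
  also have "\<dots> = l n (\<psi> x)" using label_marked_base[OF y(1)] \<psi>_b[OF x] by simp
  finally show ?thesis .
qed

text \<open>The point \<open>y\<close> is on the top floor: its image lies in \<open>Y N\<close>, so the marked tower one step earlier is that
  of \<open>y\<close>.\<close>

lemma label_below_top:
  assumes x: "x \<in> S" and n: "n < N"
  shows "\<exists>y\<in>S. l N y = l N x \<and> l n y = l n (g (\<psi> x))"
proof -
  let ?k = "t N x + r N x"
  let ?y = "(h ^^ ?k) (b N x)"
  have y: "?y \<in> S" "l N ?y = l N x" "r N ?y = 0" using same_tower[OF x, of ?k N] by auto
  have "h ?y \<in> Y N" using y r_eq_0_iff by blast
  then have "h ?y \<in> Y (Suc n)" using n Y_antimono[of "Suc n" N] by auto
  then have "l n (g (h ?y)) = l n (g (\<psi> (h ?y)))" by (rule label_marked_top)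
  then have "l n ?y = l n (g (\<psi> x))"
    using gh[OF y(1)] \<psi>_h[OF y(1)] \<psi>_hpow[OF b_in[OF x]] \<psi>_b[OF x] by simp
  then show ?thesis using y by blast
qed

lemma label_of_max_edge:
  assumes x: "x \<in> S" and e: "edge (Suc n) x \<in> Emax B"
  shows "l n x = l n (g (\<psi> x))"
proof -
  let ?k = "t n x + r n x"
  let ?y = "(h ^^ ?k) (b n x)"
  have y: "?y \<in> S" "l n ?y = l n x" "t (Suc n) ?y = ?k + offset n x" "l (Suc n) ?y = l (Suc n) x"
    using same_tower[OF x, of ?k n] same_tower_Suc[OF x, of ?k n] by auto
  have "t (Suc n) ?y + r (Suc n) ?y = t (Suc n) x + r (Suc n) x" using height_eq[OF y(1) x y(4)] .
  then have "r (Suc n) ?y = 0"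
    using y(3) edge_in_Emax_iff[OF x, of n] e offset_t[OF x, of n] by simp
  then have "h ?y \<in> Y (Suc n)" using r_eq_0_iff[OF y(1)] by blast
  then have "l n (g (h ?y)) = l n (g (\<psi> (h ?y)))" by (rule label_marked_top)
  then show ?thesis
    using gh[OF y(1)] \<psi>_h[OF y(1)] \<psi>_hpow[OF b_in[OF x]] \<psi>_b[OF x] y(2) by simp
qed

lemma marked_vertices_min:
  "\<forall>v\<in>Vmin B. \<exists>v'\<in>Vmin B. \<exists>e\<in>Emin B. src B e = v \<and> rng B e = v'"
  "\<forall>v\<in>Vmin B. \<forall>e\<in>Emin B. rng B e \<in> R_of B v \<longrightarrow> src B e = v"
  "\<forall>v\<in>Vmin B. \<forall>m>0. R_iter B m {v} = (R_iter B m \<circ> S_iter B m \<circ> R_iter B m) {v}"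
proof -
  have tz: "t n (\<psi> x) = 0" if "x \<in> S" for n x
    using t_eq_0_iff[OF \<psi>_in[OF that]] Z_Y[OF \<psi>_in_Z[OF that]] by blast
  have 1: "\<psi> (\<psi> x) = \<psi> x" if "x \<in> S" for x using \<psi>_Z \<psi>_in_Z that by blast
  have 2: "l n (\<psi> x) = l n (\<psi> x') \<and> t n (\<psi> x) = t n (\<psi> x')"
    if "x \<in> S" "x' \<in> S" "l n x = l n x'" for n x x'
    using label_fibre(1)[OF that] tz that by simp
  have 3: "edge (Suc n) (\<psi> x) \<in> Emin B" if "x \<in> S" for n x
    using edge_in_Emin_iff[OF \<psi>_in[OF that], of n] tz[OF that] by (simp add: offset_def)
  have 4: "\<exists>y\<in>S. l N y = l N x \<and> l n y = l n (\<psi> x)" if x: "x \<in> S" and n: "n < N" for n N x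
  proof -
    have "b N x \<in> Y (Suc n)" using b_in_Y[OF x, of N] Y_antimono[of "Suc n" N] n by auto
    then have "l n (b N x) = l n (\<psi> x)" using label_marked_base \<psi>_b[OF x] by metis
    then show ?thesis using b_in[OF x] base_Suc(4)[OF x] by blast
  qed
  note mv = marked_vertices[OF \<psi>_in 1 2 Emin_sub label_of_min_edge 3 4, folded Vmin_def]
  show "\<forall>v\<in>Vmin B. \<exists>v'\<in>Vmin B. \<exists>e\<in>Emin B. src B e = v \<and> rng B e = v'"
  "\<forall>v\<in>Vmin B. \<forall>e\<in>Emin B. rng B e \<in> R_of B v \<longrightarrow> src B e = v"
  "\<forall>v\<in>Vmin B. \<forall>m>0. R_iter B m {v} = (R_iter B m \<circ> S_iter B m \<circ> R_iter B m) {v}"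
    by (rule mv; assumption)+
qed

text \<open>The points \<open>g (\<psi> x)\<close> are on the top floor of their tower at every level; hence their floor, the
  height minus one, is determined by the label.\<close>

lemma marked_vertices_max:
  "\<forall>v\<in>Vmax B. \<exists>v'\<in>Vmax B. \<exists>e\<in>Emax B. src B e = v \<and> rng B e = v'"
  "\<forall>v\<in>Vmax B. \<forall>e\<in>Emax B. rng B e \<in> R_of B v \<longrightarrow> src B e = v"
  "\<forall>v\<in>Vmax B. \<forall>m>0. R_iter B m {v} = (R_iter B m \<circ> S_iter B m \<circ> R_iter B m) {v}"
proof -
  have q_in: "g (\<psi> x) \<in> S" if "x \<in> S" for x using g_in \<psi>_in that by blast
  have rz: "r n (g (\<psi> x)) = 0" if "x \<in> S" for n x
    using r_eq_0_iff[OF q_in[OF that]] hg[OF \<psi>_in[OF that]] Z_Y[OF \<psi>_in_Z[OF that]] by simp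
  have 1: "g (\<psi> (g (\<psi> x))) = g (\<psi> x)" if "x \<in> S" for x
    using \<psi>_g[OF \<psi>_in[OF that]] \<psi>_Z \<psi>_in_Z that by simp
  have 2: "l n (g (\<psi> x)) = l n (g (\<psi> x')) \<and> t n (g (\<psi> x)) = t n (g (\<psi> x'))"
    if "x \<in> S" "x' \<in> S" "l n x = l n x'" for n x x'
    using label_fibre(2)[OF that] height_eq[OF q_in[OF that(1)] q_in[OF that(2)], of n] rz that by simp
  have 3: "edge (Suc n) (g (\<psi> x)) \<in> Emax B" if "x \<in> S" for n x
    using edge_in_Emax_iff[OF q_in[OF that], of n] rz[OF that] by simp
  have 4: "\<exists>y\<in>S. l N y = l N x \<and> l n y = l n (g (\<psi> x))" if "x \<in> S" "n < N" for n N x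
    using label_below_top[OF that] by blast
  note mv = marked_vertices[of "\<lambda>x. g (\<psi> x)", OF q_in 1 2 Emax_sub label_of_max_edge 3 4, folded Vmax_def]
  show "\<forall>v\<in>Vmax B. \<exists>v'\<in>Vmax B. \<exists>e\<in>Emax B. src B e = v \<and> rng B e = v'"
  "\<forall>v\<in>Vmax B. \<forall>e\<in>Emax B. rng B e \<in> R_of B v \<longrightarrow> src B e = v"
  "\<forall>v\<in>Vmax B. \<forall>m>0. R_iter B m {v} = (R_iter B m \<circ> S_iter B m \<circ> R_iter B m) {v}"
    by (rule mv; assumption)+
qed

end

section \<open>Construction of the towers\<close>

text \<open>The base of the next level. Its points agree with the marked point of their fibre about the first
  clopen sets \<open>Q j\<close>, which forces the intersection of all bases to be \<open>Z\<close>, and they share with it the present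
  tower and the tower one step earlier.\<close>

definition refined_base :: "('a \<Rightarrow> 'a) \<Rightarrow> ('a \<Rightarrow> 'a) \<Rightarrow> (nat \<Rightarrow> 'a set) \<Rightarrow> nat \<Rightarrow> 'a set \<Rightarrow> ('a \<Rightarrow> nat) \<Rightarrow> 'a set" where
  "refined_base g \<psi> Q n Y L = {y \<in> Y. (\<forall>j\<le>n. y \<in> Q j \<longleftrightarrow> \<psi> y \<in> Q j) \<and>
     tower_label g Y L y = tower_label g Y L (\<psi> y) \<and> tower_label g Y L (g y) = tower_label g Y L (g (\<psi> y))}"

text \<open>What a point of the new base \<open>Y'\<close> sees until it returns to \<open>Y'\<close>: the position in the present towers and
  the membership in \<open>Q 0, \<dots>, Q n\<close>.\<close>

definition itinerary :: "('a \<Rightarrow> 'a) \<Rightarrow> ('a \<Rightarrow> 'a) \<Rightarrow> (nat \<Rightarrow> 'a set) \<Rightarrow> nat \<Rightarrow> 'a set \<Rightarrow> ('a \<Rightarrow> nat) \<Rightarrow> 'a set \<Rightarrow> 'a \<Rightarrow>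
    (nat \<times> nat \<times> bool list) list" where
  "itinerary h g Q n Y L Y' y =
     map (\<lambda>k. (floor_time g Y ((h ^^ k) y), tower_label g Y L ((h ^^ k) y), map (\<lambda>j. (h ^^ k) y \<in> Q j) [0..<Suc n]))
       [0..<Suc (time_to_top h Y' y)]"

text \<open>Besides the itinerary of \<open>y\<close> itself the label contains those of the towers of \<open>\<psi> y\<close> and of \<open>g (\<psi> y)\<close>. These
  two depend on the fibre only, so a tower is cut along invariant sets and its itinerary is unaffected.\<close>

definition refined_label :: "('a \<Rightarrow> 'a) \<Rightarrow> ('a \<Rightarrow> 'a) \<Rightarrow> ('a \<Rightarrow> 'a) \<Rightarrow> (nat \<Rightarrow> 'a set) \<Rightarrow> nat \<Rightarrow> 'a set \<Rightarrow> ('a \<Rightarrow> nat) \<Rightarrow>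
    'a set \<Rightarrow> 'a \<Rightarrow> nat" where
  "refined_label h g \<psi> Q n Y L Y' y = (let I = itinerary h g Q n Y L Y' in
     to_nat (I y, I (\<psi> y), I (base_point g Y' (g (\<psi> y)))))"

primrec levels :: "('a \<Rightarrow> 'a) \<Rightarrow> ('a \<Rightarrow> 'a) \<Rightarrow> ('a \<Rightarrow> 'a) \<Rightarrow> (nat \<Rightarrow> 'a set) \<Rightarrow> 'a set \<Rightarrow> nat \<Rightarrow>
    'a set \<times> ('a \<Rightarrow> nat)" where
  "levels h g \<psi> Q S 0 = (S, \<lambda>_. 0)"
| "levels h g \<psi> Q S (Suc n) = (let (Y, L) = levels h g \<psi> Q S n; Y' = refined_base g \<psi> Q n Y L
     in (Y', refined_label h g \<psi> Q n Y L Y'))"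

text \<open>Everything that the construction uses of the system: the retraction \<open>\<psi>\<close> onto \<open>Z\<close>, a sequence of clopen
  sets separating points, and recurrence to neighbourhoods of the marked point of each fibre.\<close>

locale recurrent_fibration = bijective_dynamics "topspace X" h g
  for X :: "'a topology" and h g +
  fixes \<psi> :: "'a \<Rightarrow> 'a" and Z :: "'a set" and Q :: "nat \<Rightarrow> 'a set"
  assumes nonempty: "topspace X \<noteq> {}"
    and compact: "compact_space X" and Hausdorff: "Hausdorff_space X"
    and homeo: "homeomorphic_maps X X h g"
    and \<psi>_cont: "continuous_map X X \<psi>"
    and \<psi>_in_Z: "x \<in> topspace X \<Longrightarrow> \<psi> x \<in> Z" and \<psi>_Z: "z \<in> Z \<Longrightarrow> \<psi> z = z"
    and Z_sub: "Z \<subseteq> topspace X"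
    and \<psi>_h: "x \<in> topspace X \<Longrightarrow> \<psi> (h x) = \<psi> x"
    and Q_clopen: "openin X (Q j)" "closedin X (Q j)"
    and Q_separates: "\<lbrakk>x \<in> topspace X; y \<in> topspace X; x \<noteq> y\<rbrakk> \<Longrightarrow> \<exists>j. x \<in> Q j \<and> y \<notin> Q j"
    and forward_visit: "\<lbrakk>x \<in> topspace X; openin X U; \<psi> x \<in> U\<rbrakk> \<Longrightarrow> \<exists>k. (h ^^ k) x \<in> U"
    and backward_visit: "\<lbrakk>x \<in> topspace X; openin X U; \<psi> x \<in> U\<rbrakk> \<Longrightarrow> \<exists>k. (g ^^ k) x \<in> U"
begin

abbreviation "S \<equiv> topspace X"

lemma \<psi>_in: "x \<in> S \<Longrightarrow> \<psi> x \<in> S"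
  using \<psi>_in_Z Z_sub by blast

lemma \<psi>_\<psi>: "x \<in> S \<Longrightarrow> \<psi> (\<psi> x) = \<psi> x"
  using \<psi>_in_Z \<psi>_Z by blast

lemma \<psi>_g: "x \<in> S \<Longrightarrow> \<psi> (g x) = \<psi> x"
  using \<psi>_h[of "g x"] g_in hg by simp

lemma \<psi>_base_point: "x \<in> S \<Longrightarrow> \<psi> (base_point g Y x) = \<psi> x"
proof -
  have "\<psi> ((g ^^ k) x) = \<psi> x" if "x \<in> S" for k using that by (induction k) (auto simp: \<psi>_g gpow_in)
  then show "x \<in> S \<Longrightarrow> ?thesis" unfolding base_point_def by blast
qed

lemma cont_h: "continuous_map X X h" and cont_g: "continuous_map X X g"
  using homeo unfolding homeomorphic_maps_def by auto

lemma cont_funpow: "continuous_map X X f \<Longrightarrow> continuous_map X X (f ^^ k)"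
proof (induction k)
  case 0
  have "f ^^ 0 = id" by simp
  then show ?case by simp
next
  case (Suc k)
  then show ?case unfolding funpow.simps(2) by (intro continuous_map_compose)
qed

text \<open>The invariant of the recursion.\<close>

definition good :: "'a set \<Rightarrow> ('a \<Rightarrow> nat) \<Rightarrow> bool" where
  "good Y L \<longleftrightarrow> recurrent Y \<and> Z \<subseteq> Y \<and> locally_constant X (\<lambda>x. x \<in> Y) \<and> locally_constant X L"

lemma recurrentI:
  assumes "Y \<subseteq> S" "Z \<subseteq> Y" "locally_constant X (\<lambda>x. x \<in> Y)"
  shows "recurrent Y"
  unfolding recurrent_def
proof (intro conjI ballI assms)
  fix x assume x: "x \<in> S"
  have "{x \<in> S. (x \<in> Y) \<in> {True}} = Y" using assms(1) by auto
  then have Y: "openin X Y" using openin_locally_constant_Collect[OF assms(3), of "{True}"] by simp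
  have "\<psi> x \<in> Y" using \<psi>_in_Z[OF x] assms(2) by blast
  then show "\<exists>k. (g ^^ k) x \<in> Y" using backward_visit[OF x Y] by blast
  have "\<psi> (h x) \<in> Y" using \<open>\<psi> x \<in> Y\<close> \<psi>_h[OF x] by simp
  then obtain k where "(h ^^ k) (h x) \<in> Y" using forward_visit[OF h_in[OF x] Y] by blast
  then have "(h ^^ Suc k) x \<in> Y" by (simp add: funpow_swap1)
  then show "\<exists>k. (h ^^ Suc k) x \<in> Y" by blast
qed

context
  fixes Y L assumes YL: "good Y L"
begin

lemma lcY: "locally_constant X (\<lambda>x. x \<in> Y)"
  using YL unfolding good_def by blast

lemma recY: "recurrent Y"
  using YL unfolding good_def by blast

lemma lc_floor_time: "locally_constant X (floor_time g Y)"
  unfolding floor_time_def[abs_def]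
proof (rule locally_constant_Least)
  show "locally_constant X (\<lambda>x. (g ^^ i) x \<in> Y)" for i
    by (rule locally_constant_precompose[OF lcY cont_funpow[OF cont_g]])
  show "\<exists>i. (g ^^ i) x \<in> Y" if "x \<in> S" for x
    using recY that unfolding recurrent_def by blast
qed

lemma lc_time_to_top: "locally_constant X (time_to_top h Y)"
  unfolding time_to_top_def[abs_def]
proof (rule locally_constant_Least)
  show "locally_constant X (\<lambda>x. (h ^^ Suc i) x \<in> Y)" for i
    by (rule locally_constant_precompose[OF lcY cont_funpow[OF cont_h]])
  show "\<exists>i. (h ^^ Suc i) x \<in> Y" if "x \<in> S" for x
    using recY that unfolding recurrent_def by blast
qed

lemma lc_at_base:
  assumes "locally_constant X f"
  shows "locally_constant X (\<lambda>x. f (base_point g Y x))"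
  unfolding base_point_def
  by (rule locally_constant_bind[OF lc_floor_time]) (intro locally_constant_precompose[OF assms] cont_funpow cont_g)

lemma lc_tower_label: "locally_constant X (tower_label g Y L)"
  unfolding tower_label_def[abs_def] using YL unfolding good_def by (intro lc_at_base) blast

lemma refined_base_sub: "refined_base g \<psi> Q n Y L \<subseteq> Y"
  unfolding refined_base_def by blast

lemma Z_sub_refined_base: "Z \<subseteq> refined_base g \<psi> Q n Y L"
  using YL \<psi>_Z unfolding refined_base_def good_def by auto

lemma lc_refined_base: "locally_constant X (\<lambda>x. x \<in> refined_base g \<psi> Q n Y L)"
proof -
  have Q: "locally_constant X (\<lambda>x. map (\<lambda>j. x \<in> Q j) [0..<Suc n])"
    by (intro locally_constant_map_list locally_constant_mem_clopen Q_clopen)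
  have "x \<in> refined_base g \<psi> Q n Y L \<longleftrightarrow> x \<in> Y \<and>
      (map (\<lambda>j. x \<in> Q j) [0..<Suc n] = map (\<lambda>j. \<psi> x \<in> Q j) [0..<Suc n] \<and>
      (tower_label g Y L x = tower_label g Y L (\<psi> x) \<and> tower_label g Y L (g x) = tower_label g Y L (g (\<psi> x))))" for x
    unfolding refined_base_def by (auto simp del: upt_Suc simp: less_Suc_eq_le)
  moreover have "locally_constant X (\<lambda>x. x \<in> Y \<and>
      (map (\<lambda>j. x \<in> Q j) [0..<Suc n] = map (\<lambda>j. \<psi> x \<in> Q j) [0..<Suc n] \<and>
      (tower_label g Y L x = tower_label g Y L (\<psi> x) \<and> tower_label g Y L (g x) = tower_label g Y L (g (\<psi> x)))))"
  proof (intro locally_constant_comp2[of X _ _ "(\<and>)"] locally_constant_comp2[of X _ _ "(=)"])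
    show "locally_constant X (\<lambda>x. x \<in> Y)" using YL unfolding good_def by blast
    show "locally_constant X (\<lambda>x. map (\<lambda>j. x \<in> Q j) [0..<Suc n])" by (rule Q)
    show "locally_constant X (\<lambda>x. map (\<lambda>j. \<psi> x \<in> Q j) [0..<Suc n])"
      by (rule locally_constant_precompose[OF Q \<psi>_cont])
    show "locally_constant X (tower_label g Y L)" by (rule lc_tower_label)
    show "locally_constant X (\<lambda>x. tower_label g Y L (\<psi> x))"
      by (rule locally_constant_precompose[OF lc_tower_label \<psi>_cont])
    show "locally_constant X (\<lambda>x. tower_label g Y L (g x))"
      by (rule locally_constant_precompose[OF lc_tower_label cont_g])
    show "locally_constant X (\<lambda>x. tower_label g Y L (g (\<psi> x)))"
      by (rule locally_constant_precompose[OF locally_constant_precompose[OF lc_tower_label cont_g] \<psi>_cont])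
  qed
  ultimately show ?thesis by (simp del: upt_Suc)
qed

lemma good_refined_base_const: "good (refined_base g \<psi> Q n Y L) (\<lambda>_. 0)"
proof -
  have "Y \<subseteq> S" using YL unfolding good_def recurrent_def by blast
  then have "recurrent (refined_base g \<psi> Q n Y L)"
    using refined_base_sub Z_sub_refined_base lc_refined_base by (intro recurrentI) auto
  then show ?thesis unfolding good_def using Z_sub_refined_base lc_refined_base by simp
qed

end

lemma lc_itinerary:
  assumes YL: "good Y L" and Y': "good Y' L'"
  shows "locally_constant X (itinerary h g Q n Y L Y')"
proof -
  have Q: "locally_constant X (\<lambda>x. map (\<lambda>j. x \<in> Q j) [0..<Suc n])"
    by (intro locally_constant_map_list locally_constant_mem_clopen Q_clopen)
  let ?f = "\<lambda>x. (floor_time g Y x, tower_label g Y L x, map (\<lambda>j. x \<in> Q j) [0..<Suc n])"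
  have f: "locally_constant X ?f"
    using locally_constant_comp2[of X _ _ Pair, OF lc_floor_time[OF YL]
      locally_constant_comp2[of X _ _ Pair, OF lc_tower_label[OF YL] Q]] .
  show ?thesis
    unfolding itinerary_def[abs_def]
  proof (rule locally_constant_bind[where k = "time_to_top h Y'" and F = "\<lambda>i y. map (\<lambda>k. ?f ((h ^^ k) y)) [0..<Suc i]"])
    show "locally_constant X (time_to_top h Y')" by (rule lc_time_to_top[OF Y'])
    show "locally_constant X (\<lambda>y. map (\<lambda>k. ?f ((h ^^ k) y)) [0..<Suc i])" for i
      by (intro locally_constant_map_list locally_constant_precompose[OF f] cont_funpow cont_h)
  qed
qed

lemma good_refined:
  fixes n
  assumes YL: "good Y L"
  defines "Y' \<equiv> refined_base g \<psi> Q n Y L"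
  shows "good Y' (refined_label h g \<psi> Q n Y L Y')"
proof -
  have Y': "good Y' (\<lambda>_. 0)" unfolding Y'_def by (rule good_refined_base_const[OF YL])
  let ?I = "itinerary h g Q n Y L Y'"
  have I: "locally_constant X ?I" by (rule lc_itinerary[OF YL Y'])
  have I2: "locally_constant X (\<lambda>y. ?I (\<psi> y))" by (rule locally_constant_precompose[OF I \<psi>_cont])
  have I3: "locally_constant X (\<lambda>y. ?I (base_point g Y' (g (\<psi> y))))"
    by (rule locally_constant_precompose[OF locally_constant_precompose[OF lc_at_base[OF Y' I] cont_g] \<psi>_cont])
  have "locally_constant X (refined_label h g \<psi> Q n Y L Y')"
    unfolding refined_label_def[abs_def] Let_def
    by (rule locally_constant_comp[of X _ to_nat, OF locally_constant_comp2[of X _ _ Pair, OF I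
          locally_constant_comp2[of X _ _ Pair, OF I2 I3]]])
  then show ?thesis using Y' unfolding good_def by blast
qed

definition Y :: "nat \<Rightarrow> 'a set" where "Y n = fst (levels h g \<psi> Q S n)"
definition L :: "nat \<Rightarrow> 'a \<Rightarrow> nat" where "L n = snd (levels h g \<psi> Q S n)"

lemma Y_0: "Y 0 = S" and L_0: "L 0 = (\<lambda>_. 0)"
  by (simp_all add: Y_def L_def)

lemma Y_Suc: "Y (Suc n) = refined_base g \<psi> Q n (Y n) (L n)"
  by (simp add: Y_def L_def Let_def split_beta)

lemma L_Suc: "L (Suc n) = refined_label h g \<psi> Q n (Y n) (L n) (Y (Suc n))"
  by (simp add: Y_def L_def Let_def split_beta)

lemma good_levels: "good (Y n) (L n)"
proof (induction n)
  case 0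
  have "locally_constant X (\<lambda>x. x \<in> S)" by (intro locally_constant_mem_clopen) auto
  then show ?case using recurrentI[of S] Z_sub unfolding Y_0 L_0 good_def by simp
next
  case (Suc n)
  then show ?case unfolding L_Suc unfolding Y_Suc by (rule good_refined)
qed

lemma recurrent_Y: "recurrent (Y n)"
  using good_levels[of n] unfolding good_def by blast

abbreviation "lab n \<equiv> tower_label g (Y n) (L n)"
abbreviation "itin n \<equiv> itinerary h g Q n (Y n) (L n) (Y (Suc n))"

lemma label_Suc:
  assumes x: "x \<in> S"
  shows "lab (Suc n) x = to_nat (itin n (base_point g (Y (Suc n)) x), itin n (\<psi> x),
           itin n (base_point g (Y (Suc n)) (g (\<psi> x))))"
  unfolding tower_label_def L_Suc refined_label_def Let_def \<psi>_base_point[OF x] ..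

text \<open>A label determines the height through the length of the itinerary, and together with the floor it
  determines the entry of the itinerary at that floor, which describes the point at the previous level.\<close>

lemma itinerary_nth_floor:
  assumes x: "x \<in> S"
  shows "length (itin n (base_point g (Y (Suc n)) x)) =
      Suc (floor_time g (Y (Suc n)) x + time_to_top h (Y (Suc n)) x)"
    and "itin n (base_point g (Y (Suc n)) x) ! floor_time g (Y (Suc n)) x =
      (floor_time g (Y n) x, lab n x, map (\<lambda>j. x \<in> Q j) [0..<Suc n])"
  using time_to_top_base_point[OF recurrent_Y x, of "Suc n"] hpow_base_point[OF x, of "Y (Suc n)"]
  unfolding itinerary_def by (simp_all del: upt_Suc)

lemma label_Suc_eqD:
  assumes x: "x \<in> S" "x' \<in> S" "lab (Suc n) x = lab (Suc n) x'"
  shows "itin n (base_point g (Y (Suc n)) x) = itin n (base_point g (Y (Suc n)) x')"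
    "itin n (\<psi> x) = itin n (\<psi> x')"
    "itin n (base_point g (Y (Suc n)) (g (\<psi> x))) = itin n (base_point g (Y (Suc n)) (g (\<psi> x')))"
  using x(3) unfolding label_Suc[OF x(1)] label_Suc[OF x(2)] by simp_all

lemma same_position:
  assumes x: "x \<in> S" "x' \<in> S" "lab (Suc n) x = lab (Suc n) x'"
    "floor_time g (Y (Suc n)) x = floor_time g (Y (Suc n)) x'"
  shows "floor_time g (Y n) x = floor_time g (Y n) x'" "lab n x = lab n x'"
    "j \<le> n \<Longrightarrow> x \<in> Q j \<longleftrightarrow> x' \<in> Q j"
  using itinerary_nth_floor(2)[OF x(1), of n] itinerary_nth_floor(2)[OF x(2), of n]
    label_Suc_eqD(1)[OF x(1-3)] x(4) by (auto simp del: upt_Suc)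

lemma fibred_tower_sequence: "fibred_tower_sequence X h g Y L \<psi> Z"
proof
  show "S \<noteq> {}" by (rule nonempty)
  show "compact_space X" "Hausdorff_space X" "homeomorphic_maps X X h g" "continuous_map X X \<psi>"
    by (rule compact Hausdorff homeo \<psi>_cont)+
  show "\<psi> x \<in> Z" if "x \<in> S" for x using \<psi>_in_Z that .
  show "\<psi> z = z" if "z \<in> Z" for z using \<psi>_Z that .
  show "\<psi> (h x) = \<psi> x" if "x \<in> S" for x using \<psi>_h that .
  fix n
  show "recurrent (Y n)" by (rule recurrent_Y)
  show "Y 0 = S" by (rule Y_0)
  show "L 0 x = 0" for x by (simp add: L_0)
  show "Y (Suc n) \<subseteq> Y n" unfolding Y_Suc by (rule refined_base_sub[OF good_levels])
  have lcL: "locally_constant X (L n)" using good_levels[of n] unfolding good_def by blast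
  then show "finite (L n ` S)" by (rule finite_image_locally_constant[OF compact])
  show "locally_constant X (floor_time g (Y n))" by (rule lc_floor_time[OF good_levels])
  show "locally_constant X (lab n)" by (rule lc_tower_label[OF good_levels])
  show "lab n y = lab n (\<psi> y)" "lab n (g y) = lab n (g (\<psi> y))" if "y \<in> Y (Suc n)" for y
    using that unfolding Y_Suc refined_base_def by auto
  fix x x' assume x: "x \<in> S" "x' \<in> S"
  show "floor_time g (Y n) x = floor_time g (Y n) x' \<and> lab n x = lab n x'"
    if "lab (Suc n) x = lab (Suc n) x'" "floor_time g (Y (Suc n)) x = floor_time g (Y (Suc n)) x'"
    using same_position(1,2)[OF x that] by blast
  show "floor_time g (Y n) x + time_to_top h (Y n) x = floor_time g (Y n) x' + time_to_top h (Y n) x'"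
    if eq: "lab n x = lab n x'"
  proof (cases n)
    case 0
    have "floor_time g S y = 0" "time_to_top h S y = 0" if "y \<in> S" for y
      using that recurrent_Y[of 0] time_to_top_0_iff[of S y] h_in unfolding Y_0 by auto
    then show ?thesis using x unfolding 0 Y_0 by simp
  next
    case (Suc m)
    then show ?thesis
      using label_Suc_eqD(1)[OF x, of m] eq itinerary_nth_floor(1)[OF x(1), of m]
        itinerary_nth_floor(1)[OF x(2), of m] by simp
  qed
  show "lab n (\<psi> x) = lab n (\<psi> x') \<and> lab n (g (\<psi> x)) = lab n (g (\<psi> x'))" if eq: "lab n x = lab n x'"
  proof (cases n)
    case 0
    then show ?thesis by (simp add: tower_label_def L_0)
  next
    case (Suc m)
    have Z: "Z \<subseteq> Y (Suc m)" using good_levels[of "Suc m"] unfolding good_def by blast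
    have bp: "base_point g (Y (Suc m)) (\<psi> y) = \<psi> y" if "y \<in> S" for y
      using Z \<psi>_in_Z[OF that] by (intro base_point_base) blast
    \<comment> \<open>The labels of \<open>\<psi> y\<close> and \<open>g (\<psi> y)\<close> are functions of the last two components of the label of \<open>y\<close>.\<close>
    have 1: "lab (Suc m) (\<psi> y) = to_nat (itin m (\<psi> y), itin m (\<psi> y),
        itin m (base_point g (Y (Suc m)) (g (\<psi> y))))" if "y \<in> S" for y
      using label_Suc[OF \<psi>_in[OF that]] bp[OF that] \<psi>_\<psi>[OF that] by simp
    have 2: "lab (Suc m) (g (\<psi> y)) = to_nat (itin m (base_point g (Y (Suc m)) (g (\<psi> y))), itin m (\<psi> y),
        itin m (base_point g (Y (Suc m)) (g (\<psi> y))))" if "y \<in> S" for y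
      using label_Suc[OF g_in[OF \<psi>_in[OF that]]] \<psi>_\<psi>[OF that] \<psi>_g[OF \<psi>_in[OF that]] by simp
    have "lab (Suc m) x = lab (Suc m) x'" using eq Suc by simp
    note same_itin = label_Suc_eqD[OF x this]
    have "lab (Suc m) (\<psi> x) = lab (Suc m) (\<psi> x')"
      by (simp only: 1[OF x(1)] 1[OF x(2)] same_itin(2,3))
    moreover have "lab (Suc m) (g (\<psi> x)) = lab (Suc m) (g (\<psi> x'))"
      by (simp only: 2[OF x(1)] 2[OF x(2)] same_itin(2,3))
    ultimately show ?thesis unfolding Suc by blast
  qed
  show "x = x'" if same: "\<And>n. floor_time g (Y n) x = floor_time g (Y n) x' \<and> lab n x = lab n x'"
  proof (rule ccontr)
    assume "x \<noteq> x'"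
    then obtain j where "x \<in> Q j" "x' \<notin> Q j" using Q_separates x by blast
    moreover have "x \<in> Q j \<longleftrightarrow> x' \<in> Q j"
      using same_position(3)[OF x, of j j] same[of "Suc j"] by simp
    ultimately show False by simp
  qed
next
  show "Z = (\<Inter>n. Y n)"
  proof
    show "Z \<subseteq> (\<Inter>n. Y n)" using good_levels unfolding good_def by blast
    show "(\<Inter>n. Y n) \<subseteq> Z"
    proof
      fix x assume "x \<in> (\<Inter>n. Y n)"
      then have xY: "x \<in> Y n" for n by blast
      have xS: "x \<in> S" using xY[of 0] Y_0 by simp
      have "\<psi> x = x"
      proof (rule ccontr)
        assume "\<psi> x \<noteq> x"
        then obtain j where "\<psi> x \<in> Q j" "x \<notin> Q j" using Q_separates[OF \<psi>_in[OF xS] xS] by blast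
        moreover have "x \<in> Q j \<longleftrightarrow> \<psi> x \<in> Q j" using xY[of "Suc j"] unfolding Y_Suc refined_base_def by auto
        ultimately show False by simp
      qed
      then show "x \<in> Z" using \<psi>_in_Z[OF xS] by simp
    qed
  qed
qed

end

section \<open>The Bratteli model\<close>

text \<open>Inside the fibre, \<open>z\<close> lies in the only minimal set. The backward statement is the forward one for \<open>g\<close>, as a
  homeomorphism and its inverse have the same minimal sets.\<close>

lemma fibre_recurrence:
  assumes h: "homeomorphic_maps X X h g" and \<psi>: "\<And>x. x \<in> topspace X \<Longrightarrow> \<psi> (h x) = \<psi> x"
    and em: "essentially_minimal (fiber_topology X \<psi> z) h"
    and M: "minimal_set (fiber_topology X \<psi> z) h M" "z \<in> M"
    and x: "x \<in> topspace X" "\<psi> x = z" and U: "openin X U" "z \<in> U"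
  shows "\<exists>k. (h ^^ k) x \<in> U" "\<exists>k. (g ^^ k) x \<in> U"
proof -
  let ?T = "fiber_topology X \<psi> z"
  have T: "topspace ?T = {x \<in> topspace X. \<psi> x = z}" by auto
  have comp: "compact_space ?T" "homeomorphic_map ?T ?T h"
    using em unfolding essentially_minimal_def zero_dim_system_def by auto
  have uniq: "z \<in> M'" if "minimal_set ?T h M'" for M'
    using em M that unfolding essentially_minimal_def by metis
  have "closedin ?T M" using M(1) unfolding minimal_set_def invariant_closed_set_def by simp
  then have zT: "z \<in> topspace ?T" using closedin_subset M(2) by (metis subsetD)
  have UT: "openin ?T (U \<inter> {x \<in> topspace X. \<psi> x = z})" "z \<in> U \<inter> {x \<in> topspace X. \<psi> x = z}"
    using U zT unfolding T by (auto simp: openin_subtopology)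
  have xT: "x \<in> topspace ?T" using x T by blast
  show "\<exists>k. (h ^^ k) x \<in> U"
    using orbit_meets_neighbourhood_of_unique_minimal_set[OF comp uniq xT UT] by blast
  have hg: "continuous_map X X h" "continuous_map X X g"
    "\<And>y. y \<in> topspace X \<Longrightarrow> g (h y) = y" "\<And>y. y \<in> topspace X \<Longrightarrow> h (g y) = y"
    using h unfolding homeomorphic_maps_def by auto
  have in_X: "h y \<in> topspace X" "g y \<in> topspace X" if "y \<in> topspace X" for y
    using hg(1,2) that by (auto simp: continuous_map_def)
  have \<psi>g: "\<psi> (g y) = \<psi> y" if "y \<in> topspace X" for y
    using \<psi>[OF in_X(2)[OF that]] hg(4)[OF that] by simp
  have maps: "homeomorphic_maps ?T ?T h g"
    unfolding homeomorphic_maps_def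
  proof (intro conjI ballI)
    show "continuous_map ?T ?T h"
      using hg(1) in_X \<psi> by (intro continuous_map_into_subtopology continuous_map_from_subtopology) auto
    show "continuous_map ?T ?T g"
      using hg(2) in_X \<psi>g by (intro continuous_map_into_subtopology continuous_map_from_subtopology) auto
  qed (use hg in auto)
  then have "homeomorphic_map ?T ?T g" using homeomorphic_maps_map by blast
  moreover have "z \<in> M'" if "minimal_set ?T g M'" for M'
    using that minimal_set_inverse[OF maps] uniq by blast
  ultimately show "\<exists>k. (g ^^ k) x \<in> U"
    using orbit_meets_neighbourhood_of_unique_minimal_set[OF comp(1) _ _ xT UT, of g] by blast
qed

theorem proposition3p8:
  fixes X :: "'a topology" and h :: "'a \<Rightarrow> 'a" and Z :: "'a set"
  assumes "fiberwise_essentially_minimal X h Z"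
    and "topspace X \<noteq> {}"
  shows "\<exists>(B :: (nat, nat) bratteli) h\<^sub>B.
     ordered_bratteli_diagram B \<and> perfect_ordering B \<and> vershik_transformation B h\<^sub>B \<and>
     conjugate_triples (path_topology B) h\<^sub>B (paths_min B) X h Z \<and>
     (\<forall>v\<in>Vmin B. \<exists>v'\<in>Vmin B. \<exists>e\<in>Emin B. src B e = v \<and> rng B e = v') \<and>
     (\<forall>v\<in>Vmax B. \<exists>v'\<in>Vmax B. \<exists>e\<in>Emax B. src B e = v \<and> rng B e = v') \<and>
     (\<forall>v\<in>Vmin B. \<forall>e\<in>Emin B. rng B e \<in> R_of B v \<longrightarrow> src B e = v) \<and>
     (\<forall>v\<in>Vmax B. \<forall>e\<in>Emax B. rng B e \<in> R_of B v \<longrightarrow> src B e = v) \<and>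
     (\<forall>v\<in>Vmin B \<union> Vmax B. \<forall>m>0.
        R_iter B m {v} = (R_iter B m \<circ> S_iter B m \<circ> R_iter B m) {v})"
proof -
  have zd: "zero_dim_system X h" and Z: "closedin X Z"
    using assms(1) unfolding fiberwise_essentially_minimal_def by auto
  obtain \<psi> where quot: "quotient_map X (subtopology X Z) \<psi>" and \<psi>_Z: "\<forall>z\<in>Z. \<psi> z = z"
    and \<psi>_h: "\<forall>x\<in>topspace X. \<psi> (h x) = \<psi> x"
    and em: "\<forall>z\<in>Z. essentially_minimal (fiber_topology X \<psi> z) h \<and>
                  (\<exists>M. minimal_set (fiber_topology X \<psi> z) h M \<and> z \<in> M)"
    using assms(1) unfolding fiberwise_essentially_minimal_def by auto
  have X: "compact_space X" "metrizable_space X" "totally_disconnected_space X" "homeomorphic_map X X h"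
    using zd unfolding zero_dim_system_def by auto
  have Z_sub: "Z \<subseteq> topspace X" using closedin_subset[OF Z] .
  have \<psi>: "continuous_map X X \<psi>" "\<And>x. x \<in> topspace X \<Longrightarrow> \<psi> x \<in> Z"
    using quotient_imp_continuous_map[OF quot] by (auto simp: continuous_map_in_subtopology)
  obtain g where g: "homeomorphic_maps X X h g" using X(4) homeomorphic_map_maps by blast
  obtain Q :: "nat \<Rightarrow> 'a set" where Q: "\<And>j. openin X (Q j)" "\<And>j. closedin X (Q j)"
    "\<And>x y. \<lbrakk>x \<in> topspace X; y \<in> topspace X; x \<noteq> y\<rbrakk> \<Longrightarrow> \<exists>j. x \<in> Q j \<and> y \<notin> Q j"
    using clopen_sequence_separating_points[OF X(1-3)] by metis
  interpret D: recurrent_fibration X h g \<psi> Z Q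
  proof
    show "h x \<in> topspace X" "g x \<in> topspace X" "g (h x) = x" "h (g x) = x" if "x \<in> topspace X" for x
      using g that unfolding homeomorphic_maps_def continuous_map_def by auto
    show "Hausdorff_space X" using X(2) by (rule metrizable_imp_Hausdorff_space)
    fix x U assume x: "x \<in> topspace X" and U: "openin X U" "\<psi> x \<in> U"
    obtain M where M: "essentially_minimal (fiber_topology X \<psi> (\<psi> x)) h"
      "minimal_set (fiber_topology X \<psi> (\<psi> x)) h M" "\<psi> x \<in> M"
      using em \<psi>(2)[OF x] by blast
    show "\<exists>k. (h ^^ k) x \<in> U" "\<exists>k. (g ^^ k) x \<in> U"
      using fibre_recurrence[OF g _ M x refl U] \<psi>_h by auto
  qed (use assms(2) X g \<psi> \<psi>_Z \<psi>_h Z_sub Q in auto)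
  interpret K: fibred_tower_sequence X h g D.Y D.L \<psi> Z
    by (rule D.fibred_tower_sequence)
  obtain h\<^sub>B where "vershik_transformation K.B h\<^sub>B"
    "conjugate_triples (path_topology K.B) h\<^sub>B (paths_min K.B) X h Z"
    using K.vershik_system_conjugate by blast
  then show ?thesis
    using K.ordered_bratteli_diagram_B K.perfect_ordering_B K.marked_vertices_min K.marked_vertices_max
    by (intro exI[of _ K.B] exI[of _ h\<^sub>B] conjI) (assumption | blast)+
qed

end
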